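(* Let $n\ge 1$ be an integer and $c>0$. There are no closed $\mathbb S^3$-invariant hypersurfaces of $\mathbb S^{4n+3}(c)$ such that $$|A|^2<\frac{1}{4n}|H|^2+4c.$$
   Context: $\mathbb S^{4n+3}(c)$ is the sphere of constant sectional curvature $c$, viewed as a round sphere in $\mathbb H^{n+1}$ ($\mathbb H$ the quaternions); $\mathbb S^3$ is the group of unit quaternions acting on it by scalar multiplication $(\lambda,z)\mapsto\lambda z$, and $\mathbb S^3$-invariant means invariant under this isometric action. Closed means compact without boundary. $A$ is the second fundamental form of the hypersurface and $H=\operatorname{tr}A$ its mean curvature vector (trace not divided by the dimension). *)

theory Defs
  imports "HOL-Analysis.Analysis"
begin

section \<open>Quaternions and the scalar action of the unit quaternions\<close>

text \<open>
  A quaternion \<open>a + b i + c j + d k\<close> is the vector \<open>(a, b, c, d)\<close>, so the norm of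
  \<^typ>\<open>real^4\<close> is the quaternionic absolute value, and the inner product of \<open>quat^'k\<close> is
  the standard real inner product of the left quaternionic space of dimension \<open>CARD('k)\<close>.
\<close>

type_synonym quat = "real^4"

definition qmul :: "quat \<Rightarrow> quat \<Rightarrow> quat"  (infixl "*\<^sub>H" 70)
  where "p *\<^sub>H q = vector
    [p$1 * q$1 - p$2 * q$2 - p$3 * q$3 - p$4 * q$4,
     p$1 * q$2 + p$2 * q$1 + p$3 * q$4 - p$4 * q$3,
     p$1 * q$3 - p$2 * q$4 + p$3 * q$1 + p$4 * q$2,
     p$1 * q$4 + p$2 * q$3 - p$3 * q$2 + p$4 * q$1]"

definition qscale :: "quat \<Rightarrow> quat^'k \<Rightarrow> quat^'k"
  where "qscale p z = (\<chi> i. p *\<^sub>H (z$i))"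

lemma qmul_nth [simp]:
  "(p *\<^sub>H q)$1 = p$1 * q$1 - p$2 * q$2 - p$3 * q$3 - p$4 * q$4"
  "(p *\<^sub>H q)$2 = p$1 * q$2 + p$2 * q$1 + p$3 * q$4 - p$4 * q$3"
  "(p *\<^sub>H q)$3 = p$1 * q$3 - p$2 * q$4 + p$3 * q$1 + p$4 * q$2"
  "(p *\<^sub>H q)$4 = p$1 * q$4 + p$2 * q$3 - p$3 * q$2 + p$4 * q$1"
  by (simp_all add: qmul_def vector_def)

lemma norm_qmul: "norm (p *\<^sub>H q) = norm p * norm q"
proof -
  have "(norm (p *\<^sub>H q))\<^sup>2 = (norm p * norm q)\<^sup>2"
    unfolding power_mult_distrib power2_norm_eq_inner inner_vec_def sum_4 inner_real_def
      qmul_nth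
    by algebra
  then show ?thesis
    by (simp add: power2_eq_iff_nonneg)
qed

text \<open>
  For immersed hypersurfaces \<open>F : M \<rightarrow> S\<close>, invariance is imposed on the image \<open>F(M)\<close> only;
  any action of the unit quaternions on \<open>M\<close> making \<open>F\<close> equivariant implies it.
\<close>

definition S3_invariant :: "(quat^'k) set \<Rightarrow> bool"
  where "S3_invariant X \<longleftrightarrow> (\<forall>p. norm p = 1 \<longrightarrow> qscale p ` X = X)"


section \<open>Smooth maps and closed smooth manifolds\<close>

primrec Ck_on :: "nat \<Rightarrow> 'a::real_normed_vector set \<Rightarrow> ('a \<Rightarrow> 'b::real_normed_vector) \<Rightarrow> bool"
  where
    "Ck_on 0 S f \<longleftrightarrow> continuous_on S f"
  | "Ck_on (Suc k) S f \<longleftrightarrow> (\<forall>x\<in>S. f differentiable (at x)) \<and>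
       (\<forall>v. Ck_on k S (\<lambda>x. frechet_derivative f (at x) v))"

text \<open>Only meaningful for open \<open>S\<close> and finite-dimensional domain.\<close>

definition smooth_on :: "'a::real_normed_vector set \<Rightarrow> ('a \<Rightarrow> 'b::real_normed_vector) \<Rightarrow> bool"
  where "smooth_on S f \<longleftrightarrow> (\<forall>k. Ck_on k S f)"

type_synonym ('p, 'm) atlas = "('p set \<times> ('p \<Rightarrow> real^'m)) set"

abbreviation parametrization :: "'p set \<Rightarrow> ('p \<Rightarrow> real^'m) \<Rightarrow> (real^'m \<Rightarrow> 'p)"
  where "parametrization U \<phi> \<equiv> inv_into U \<phi>"

definition smooth_atlas :: "'p topology \<Rightarrow> ('p, 'm::finite) atlas \<Rightarrow> bool"
  where "smooth_atlas M \<A> \<longleftrightarrow>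
    (\<Union>(U, \<phi>)\<in>\<A>. U) = topspace M \<and>
    (\<forall>(U, \<phi>)\<in>\<A>. openin M U \<and> open (\<phi> ` U) \<and>
       homeomorphic_map (subtopology M U) (top_of_set (\<phi> ` U)) \<phi>) \<and>
    (\<forall>(U, \<phi>)\<in>\<A>. \<forall>(V, \<psi>)\<in>\<A>. smooth_on (\<phi> ` (U \<inter> V)) (\<psi> \<circ> parametrization U \<phi>))"

text \<open>
  Closed means compact without boundary: charts map onto open subsets of \<open>\<real>\<^sup>m\<close>.  Second
  countability follows from compactness.  Manifolds are nonempty, but need not be connected.
\<close>

definition closed_manifold :: "'p topology \<Rightarrow> ('p, 'm::finite) atlas \<Rightarrow> bool"
  where "closed_manifold M \<A> \<longleftrightarrow>
    topspace M \<noteq> {} \<and> compact_space M \<and> Hausdorff_space M \<and> smooth_atlas M \<A>"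


section \<open>Closed immersed hypersurfaces of a round sphere\<close>

text \<open>The sphere of radius \<open>r\<close> has constant sectional curvature \<open>1 / r\<^sup>2\<close>.\<close>

definition sphere_of_curvature :: "real \<Rightarrow> 'e::euclidean_space set"
  where "sphere_of_curvature c = sphere 0 (1 / sqrt c)"

text \<open>
  The sphere is an embedded submanifold, so smoothness and immersivity of a map into it may be
  tested in the ambient Euclidean space.  The sphere has dimension \<open>DIM('e) - 1\<close>, hence a
  hypersurface of it has dimension \<open>DIM('e) - 2\<close>.
\<close>

definition closed_hypersurface ::
    "'p topology \<Rightarrow> ('p, 'm::finite) atlas \<Rightarrow> ('p \<Rightarrow> 'e::euclidean_space) \<Rightarrow> real \<Rightarrow> bool"
  where "closed_hypersurface M \<A> F c \<longleftrightarrow>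
    closed_manifold M \<A> \<and>
    CARD('m) + 2 = DIM('e) \<and>
    F ` topspace M \<subseteq> sphere_of_curvature c \<and>
    (\<forall>(U, \<phi>)\<in>\<A>. smooth_on (\<phi> ` U) (F \<circ> parametrization U \<phi>) \<and>
       (\<forall>u\<in>\<phi> ` U. inj (frechet_derivative (F \<circ> parametrization U \<phi>) (at u))))"


section \<open>Second fundamental form and mean curvature\<close>

text \<open>
  In this section \<open>f\<close> is a local parametrization, with domain an open subset of \<open>\<real>\<^sup>m\<close>, of a
  submanifold of a sphere centred at the origin.
\<close>

definition pd :: "'m::finite \<Rightarrow> (real^'m \<Rightarrow> 'e::real_normed_vector) \<Rightarrow> real^'m \<Rightarrow> 'e"
  where "pd i f u = frechet_derivative f (at u) (axis i 1)"

definition metric :: "(real^'m::finite \<Rightarrow> 'e::euclidean_space) \<Rightarrow> real^'m \<Rightarrow> real^'m^'m"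
  where "metric f u = (\<chi> i j. pd i f u \<bullet> pd j f u)"

text \<open>
  Normal space of the submanifold inside the sphere: the tangent space of the sphere at \<open>f u\<close>
  is the orthogonal complement of \<open>f u\<close>.
\<close>

definition normal_space :: "(real^'m::finite \<Rightarrow> 'e::euclidean_space) \<Rightarrow> real^'m \<Rightarrow> 'e set"
  where "normal_space f u = {w. w \<bullet> f u = 0 \<and> (\<forall>i. w \<bullet> pd i f u = 0)}"

definition orth_proj :: "'e::euclidean_space set \<Rightarrow> 'e \<Rightarrow> 'e"
  where "orth_proj N v = (THE w. w \<in> N \<and> (\<forall>y\<in>N. (v - w) \<bullet> y = 0))"

text \<open>
  Gauss formula: the Levi-Civita connection of the sphere is the tangential part of the flat
  derivative, so \<open>A(\<partial>\<^sub>i, \<partial>\<^sub>j)\<close>, the component of the covariant derivative normal to the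
  submanifold, is the projection of \<open>\<partial>\<^sub>i \<partial>\<^sub>j f\<close> to the normal space above.
\<close>

definition second_ff ::
    "(real^'m::finite \<Rightarrow> 'e::euclidean_space) \<Rightarrow> real^'m \<Rightarrow> 'm \<Rightarrow> 'm \<Rightarrow> 'e"
  where "second_ff f u i j = orth_proj (normal_space f u) (pd i (pd j f) u)"

text \<open>\<open>|A|\<^sup>2 = g\<^sup>i\<^sup>k g\<^sup>j\<^sup>l \<langle>A\<^sub>i\<^sub>j, A\<^sub>k\<^sub>l\<rangle>\<close> and \<open>H = g\<^sup>i\<^sup>j A\<^sub>i\<^sub>j\<close>; both are independent of the chart.\<close>

definition norm_A_sq :: "(real^'m::finite \<Rightarrow> 'e::euclidean_space) \<Rightarrow> real^'m \<Rightarrow> real"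
  where "norm_A_sq f u = (let G = matrix_inv (metric f u) in
    \<Sum>i\<in>UNIV. \<Sum>j\<in>UNIV. \<Sum>k\<in>UNIV. \<Sum>l\<in>UNIV.
      G$i$k * G$j$l * (second_ff f u i j \<bullet> second_ff f u k l))"

definition mean_curvature :: "(real^'m::finite \<Rightarrow> 'e::euclidean_space) \<Rightarrow> real^'m \<Rightarrow> 'e"
  where "mean_curvature f u = (let G = matrix_inv (metric f u) in
    \<Sum>i\<in>UNIV. \<Sum>j\<in>UNIV. G$i$j *\<^sub>R second_ff f u i j)"

end

theory Submission
  imports Defs
begin

text \<open>
  The inequality fails at every point near which the orbits of the unit quaternions are tangent to
  the hypersurface.  Let \<open>f\<close> parametrize such a piece of a hypersurface of the sphere of
  curvature \<open>c\<close>, with unit normal \<open>\<nu>\<close> and second fundamental form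
  \<open>h(x, y) = \<langle>\<nu>, D\<^sup>2f(x, y)\<rangle>\<close>.  For an imaginary unit quaternion \<open>p\<close> the vector
  \<open>\<xi>\<^sub>p = \<surd>c p f\<close> is a unit tangent vector, the direction of an orbit.  Differentiating the
  tangency \<open>\<langle>\<nu>, p f\<rangle> = 0\<close> along the hypersurface shows \<open>h(\<xi>\<^sub>p, y) = \<surd>c \<langle>\<nu>, p y\<rangle>\<close>, that is,
  the shape operator maps \<open>\<xi>\<^sub>p\<close> to \<open>- \<surd>c p \<nu>\<close>.  This vector has length \<open>\<surd>c\<close> and is orthogonal to
  every \<open>\<xi>\<^sub>q\<close>, since \<open>\<nu>\<close> is orthogonal to the whole quaternionic line through \<open>f\<close>.

  Take the two orthonormal vectors \<open>\<xi>\<^sub>i\<close> and \<open>\<xi>\<^sub>j\<close>.  The off-diagonal entries of \<open>h\<close> that they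
  produce contribute \<open>2 (c + c) = 4 c\<close> to \<open>|A|\<^sup>2\<close> and nothing to the trace, because \<open>h\<close> vanishes on
  their span.  The trace \<open>H\<close> comes from the remaining \<open>4n + 2 - 2 = 4n\<close> dimensions, where the
  Cauchy-Schwarz inequality gives at least \<open>|H|\<^sup>2 / (4n)\<close>.  So \<open>|A|\<^sup>2 \<ge> |H|\<^sup>2 / (4n) + 4 c\<close>
  (\<open>trace_sq_le_of_null_family\<close>, \<open>curvature_bound_if_hopf_fibres_tangent\<close>).

  Since only the image of the immersion is invariant, an orbit might a priori leave one sheet of
  the hypersurface and continue on another one, and then \<open>\<xi>\<^sub>p\<close> need not be tangent.  This is where
  compactness enters: the image is a finite union of closed embedded pieces, hence one of them has
  interior relative to the whole image (\<open>exists_chart_with_relatively_open_image\<close>).  In that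
  interior an orbit stays on the piece for a short time, so that its velocity is tangent
  (\<open>hopf_fibre_tangent_if_image_locally_invariant\<close>).
\<close>


section \<open>Scalar multiplication by quaternions\<close>

lemma qmul_assoc: "(p *\<^sub>H q) *\<^sub>H r = p *\<^sub>H (q *\<^sub>H r)"
  unfolding vec_eq_iff forall_4 qmul_nth by (auto simp: algebra_simps)

lemma qscale_qscale: "qscale p (qscale q z) = qscale (p *\<^sub>H q) z"
  by (simp add: qscale_def qmul_assoc)

lemma qscale_one: "qscale (axis 1 1) z = z"
  unfolding qscale_def vec_eq_iff forall_4 qmul_nth by (simp add: axis_def)

lemma linear_qscale_left: "linear (\<lambda>p. qscale p z)"
proof
  show "qscale (p + q) z = qscale p z + qscale q z" for p q
    unfolding qscale_def vec_eq_iff forall_4 qmul_nth vec_lambda_beta vector_add_component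
    by (simp add: algebra_simps)
  show "qscale (r *\<^sub>R p) z = r *\<^sub>R qscale p z" for r p
    unfolding qscale_def vec_eq_iff forall_4 qmul_nth vec_lambda_beta vector_scaleR_component
    by (simp add: algebra_simps)
qed

lemma linear_qscale: "linear (qscale p)"
proof
  show "qscale p (z + w) = qscale p z + qscale p w" for z w
    unfolding qscale_def vec_eq_iff forall_4 qmul_nth vec_lambda_beta vector_add_component
    by (simp add: algebra_simps)
  show "qscale p (r *\<^sub>R z) = r *\<^sub>R qscale p z" for r z
    unfolding qscale_def vec_eq_iff forall_4 qmul_nth vec_lambda_beta vector_scaleR_component
    by (simp add: algebra_simps)
qed

lemma inner_qscale_qscale: "qscale p z \<bullet> qscale q z = (p \<bullet> q) * (z \<bullet> z)"
proof -
  have "(p *\<^sub>H x) \<bullet> (q *\<^sub>H x) = (p \<bullet> q) * (x \<bullet> x)" for x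
    unfolding inner_vec_def sum_4 inner_real_def qmul_nth by algebra
  then show ?thesis
    by (simp add: qscale_def inner_vec_def[of _ "_ :: quat^'a"] sum_distrib_left)
qed

text \<open>
  Imaginary quaternions act by skew-symmetric maps, being generators of a group of isometries.
\<close>

lemma inner_qscale_skew:
  assumes "p $ 1 = 0"
  shows "w \<bullet> qscale p z = - (qscale p w \<bullet> z)"
proof -
  have "x \<bullet> (p *\<^sub>H y) = - ((p *\<^sub>H x) \<bullet> y)" for x y
    unfolding inner_vec_def sum_4 inner_real_def qmul_nth assms by (simp add: algebra_simps)
  then show ?thesis
    by (simp add: qscale_def inner_vec_def[of _ "_ :: quat^'a"] sum_negf)
qed


section \<open>Symmetric matrices with a totally null orthonormal family\<close>

definition outer :: "real^'m \<Rightarrow> real^'m \<Rightarrow> real^'m^'m::finite"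
  where "outer x y = (\<chi> i j. x $ i * y $ j)"

lemma inner_matrix_outer: "B \<bullet> outer x y = x \<bullet> (B *v y)"
  by (simp add: outer_def inner_vec_def matrix_vector_mult_def sum_distrib_left mult_ac)

lemma outer_mult_vector: "outer x y *v z = (y \<bullet> z) *\<^sub>R x"
  by (simp add: outer_def inner_vec_def matrix_vector_mult_def vec_eq_iff sum_distrib_left mult_ac)

lemma inner_outer_outer: "outer a b \<bullet> outer x y = (a \<bullet> x) * (b \<bullet> y)"
  by (simp add: inner_matrix_outer outer_mult_vector inner_commute)

lemma inner_mat_1: "B \<bullet> mat 1 = trace (B :: real^'m^'m)"
  by (simp add: inner_vec_def mat_def trace_def if_distrib cong: if_cong)

lemma trace_outer: "trace (outer x y) = x \<bullet> y"
  by (simp add: outer_def trace_def inner_vec_def)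

text \<open>
  Complete the \<open>x\<^sub>i\<close> to an orthonormal basis.  The block of \<open>B\<close> on their span is zero, the two
  off-diagonal blocks have squared norm \<open>\<Sum> |B x\<^sub>i|\<^sup>2\<close> each, and the remaining diagonal block, of
  size \<open>m - |I|\<close>, carries the whole trace, which its norm bounds by the Cauchy-Schwarz inequality.
  The proof avoids the basis: \<open>Q\<close> is the sum of the two off-diagonal blocks and \<open>P\<close> the projection
  to the complement of the span, so that the last block is \<open>B - Q\<close> and its trace is
  \<open>(B - Q) \<bullet> P\<close>.
\<close>

lemma trace_sq_le_of_null_family:
  fixes B :: "real^'m^'m" and x :: "'i \<Rightarrow> real^'m"
  assumes sym: "transpose B = B" and fin: "finite I"
    and orth: "\<And>i j. i \<in> I \<Longrightarrow> j \<in> I \<Longrightarrow> x i \<bullet> x j = (if i = j then 1 else 0)"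
    and null: "\<And>i j. i \<in> I \<Longrightarrow> j \<in> I \<Longrightarrow> x i \<bullet> (B *v x j) = 0"
  shows "(trace B)\<^sup>2 \<le> (B \<bullet> B - 2 * (\<Sum>i\<in>I. (norm (B *v x i))\<^sup>2)) * (real CARD('m) - real (card I))"
proof -
  define w where "w = (\<lambda>i. B *v x i)"
  define Q where "Q = (\<Sum>i\<in>I. outer (x i) (w i) + outer (w i) (x i))"
  define P where "P = mat 1 - (\<Sum>i\<in>I. outer (x i) (x i))"
  have sym': "y \<bullet> (B *v z) = (B *v y) \<bullet> z" for y z
    using sym by (metis dot_lmul_matrix vector_transpose_matrix)
  have xw: "x i \<bullet> w j = 0" "w j \<bullet> x i = 0" if "i \<in> I" "j \<in> I" for i j
    using null that by (auto simp: w_def inner_commute)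
  have BQ: "B \<bullet> Q = 2 * (\<Sum>i\<in>I. (norm (w i))\<^sup>2)"
    unfolding Q_def inner_sum_right inner_add_right inner_matrix_outer sum_distrib_left
    by (rule sum.cong) (auto simp: sym' w_def power2_norm_eq_inner)
  have "Q \<bullet> Q = (\<Sum>i\<in>I. \<Sum>j\<in>I. if i = j then 2 * (w i \<bullet> w j) else 0)"
    unfolding Q_def inner_sum_right inner_sum_left inner_add_right inner_add_left inner_outer_outer
    by (intro sum.cong refl, simp add: orth xw inner_commute flip: sum.distrib) (auto intro!: sum.cong)
  also have "\<dots> = 2 * (\<Sum>i\<in>I. (norm (w i))\<^sup>2)"
    using fin by (simp add: power2_norm_eq_inner sum_distrib_left)
  finally have QQ: "Q \<bullet> Q = 2 * (\<Sum>i\<in>I. (norm (w i))\<^sup>2)" .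
  have CC: "(B - Q) \<bullet> (B - Q) = B \<bullet> B - 2 * (\<Sum>i\<in>I. (norm (w i))\<^sup>2)"
    using BQ QQ by (simp add: inner_diff_left inner_diff_right inner_commute)
  have BP: "B \<bullet> P = trace B"
    by (simp add: P_def inner_diff_right inner_mat_1 inner_sum_right inner_matrix_outer null)
  have "Q \<bullet> mat 1 = 0"
    unfolding Q_def inner_sum_left inner_add_left by (simp add: inner_mat_1 trace_outer xw)
  moreover have "Q \<bullet> (\<Sum>i\<in>I. outer (x i) (x i)) = 0"
    unfolding Q_def inner_sum_right inner_sum_left inner_add_left inner_outer_outer by (simp add: xw)
  ultimately have QP: "Q \<bullet> P = 0" by (simp add: P_def inner_diff_right)
  have "(\<Sum>i\<in>I. outer (x i) (x i)) \<bullet> (\<Sum>i\<in>I. outer (x i) (x i)) = (\<Sum>i\<in>I. \<Sum>j\<in>I. if i = j then 1 else 0)"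
    unfolding inner_sum_right inner_sum_left inner_outer_outer
    by (intro sum.cong refl) (auto simp: orth)
  then have "(\<Sum>i\<in>I. outer (x i) (x i)) \<bullet> (\<Sum>i\<in>I. outer (x i) (x i)) = real (card I)"
    using fin by simp
  moreover have "(\<Sum>i\<in>I. outer (x i) (x i)) \<bullet> mat 1 = real (card I)"
    unfolding inner_sum_left by (simp add: inner_mat_1 trace_outer orth)
  moreover have "mat 1 \<bullet> (mat 1 :: real^'m^'m) = real CARD('m)"
    unfolding inner_mat_1 by (simp add: trace_I)
  ultimately have PP: "P \<bullet> P = real CARD('m) - real (card I)"
    unfolding P_def by (simp add: inner_diff_left inner_diff_right inner_commute)
  have "((B - Q) \<bullet> P)\<^sup>2 \<le> ((B - Q) \<bullet> (B - Q)) * (P \<bullet> P)"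
    by (rule Cauchy_Schwarz_ineq)
  then show ?thesis
    unfolding CC PP by (simp add: inner_diff_left BP QP w_def)
qed


section \<open>Curvature quantities in an orthonormal frame\<close>

lemma inner_matrix_trace: "A \<bullet> B = trace (transpose A ** B)"
  for A B :: "real^'m^'n"
  unfolding inner_vec_def trace_def matrix_matrix_mult_def transpose_def
  by (subst sum.swap) simp

lemma inner_matrix_mult_right: "A \<bullet> (C ** D) = (transpose C ** A) \<bullet> D"
  for A :: "real^'m^'n"
  by (simp add: inner_matrix_trace matrix_transpose_mul matrix_mul_assoc)

lemma inner_matrix_mult_left: "A \<bullet> (C ** D) = (A ** transpose D) \<bullet> C"
  for A :: "real^'m^'n"
proof -
  have "A \<bullet> (C ** D) = trace ((transpose A ** C) ** D)"
    by (simp add: inner_matrix_trace matrix_mul_assoc)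
  also have "\<dots> = trace (D ** (transpose A ** C))" by (rule trace_mul_sym)
  finally show ?thesis
    by (simp add: inner_matrix_trace matrix_transpose_mul matrix_mul_assoc)
qed

lemma inner_bilinear_form_matrix:
  fixes b :: "real^'m \<Rightarrow> real^'m \<Rightarrow> real"
  assumes "\<And>x. linear (\<lambda>y. b y x)" "\<And>y. linear (b y)"
  shows "y \<bullet> ((\<chi> i j. b (axis i 1) (axis j 1)) *v x) = b y x"
proof -
  have "b y x = b (\<Sum>i\<in>UNIV. y $ i *\<^sub>R axis i 1) (\<Sum>j\<in>UNIV. x $ j *\<^sub>R axis j 1)"
    using basis_expansion[of x] basis_expansion[of y] by (simp add: scalar_mult_eq_scaleR)
  also have "\<dots> = (\<Sum>i\<in>UNIV. \<Sum>j\<in>UNIV. y $ i * (x $ j * b (axis i 1) (axis j 1)))"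
    by (simp add: linear_sum[OF assms(1)] linear_sum[OF assms(2)] linear_cmul[OF assms(1)] linear_cmul[OF assms(2)] sum_distrib_left)
       (subst sum.swap, simp add: mult_ac)
  finally show ?thesis
    by (simp add: inner_vec_def matrix_vector_mult_def sum_distrib_left mult_ac)
qed

lemma inner_matrix_congruence:
  fixes E A :: "real^'m^'m"
  shows "y \<bullet> ((transpose E ** A ** E) *v x) = (E *v y) \<bullet> (A *v (E *v x))"
  by (metis dot_lmul_matrix vector_transpose_matrix matrix_vector_mul_assoc)

lemma matrix_inv_eqI:
  fixes A B :: "real^'m^'m"
  assumes "A ** B = mat 1"
  shows "matrix_inv A = B"
proof -
  have BA: "B ** A = mat 1" using assms by (simp add: matrix_left_right_inverse)
  have "A ** matrix_inv A = mat 1 \<and> matrix_inv A ** A = mat 1"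
    unfolding matrix_inv_def by (rule someI[of _ B]) (simp add: assms BA)
  then show ?thesis
    using BA by (metis matrix_mul_assoc matrix_mul_lid matrix_mul_rid)
qed

text \<open>
  An isometry \<open>J\<close> onto the tangent space \<open>range D\<close> replaces a Gram-Schmidt frame: its values on the
  standard basis are orthonormal tangent vectors, and the columns of \<open>E\<close> are their coordinates with
  respect to \<open>D\<close>.  The Gram matrix \<open>g\<close> of \<open>D\<close> becomes the identity in this frame,
  \<open>E\<^sup>T g E = 1\<close>, which is equivalent to \<open>inverse g = E E\<^sup>T\<close>.
\<close>

lemma orthonormal_frame_of_injective:
  fixes D :: "real^'m \<Rightarrow> 'e::euclidean_space"
  assumes "linear D" "inj D"
  obtains J and E :: "real^'m^'m"
  where "linear J" "range J = range D" "\<And>x y. J x \<bullet> J y = x \<bullet> y" "\<And>x. D (E *v x) = J x"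
    "matrix_inv (\<chi> i j. D (axis i 1) \<bullet> D (axis j 1)) = E ** transpose E"
proof -
  obtain L where L: "linear L" "L \<circ> D = id" using linear_injective_left_inverse[OF assms] by blast
  have subD: "subspace (range D)" using assms(1) by (simp add: linear_subspace_image)
  have dimD: "dim (UNIV :: (real^'m) set) = dim (range D)"
    by (rule dim_image_eq[symmetric]) (use assms in auto)
  obtain J :: "real^'m \<Rightarrow> 'e" where J: "linear J" "range J = range D" "\<And>x. norm (J x) = norm x"
    using isometry_subspaces[OF subspace_UNIV subD dimD] by (metis UNIV_I)
  \<comment> \<open>polarization\<close>
  have Jin: "J x \<bullet> J y = x \<bullet> y" for x y
  proof -
    have "x \<bullet> y = ((norm (x + y))\<^sup>2 - (norm x)\<^sup>2 - (norm y)\<^sup>2) / 2" for x y :: "'x::real_inner"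
      by (simp add: power2_norm_eq_inner inner_add_left inner_add_right inner_commute)
    then show ?thesis using J(3) linear_add[OF J(1)] by metis
  qed
  define E where "E = matrix (L \<circ> J)"
  have "E *v x = L (J x)" for x
    unfolding E_def using matrix_vector_mul(2)[OF linear_compose[OF J(1) L(1)]] by (metis comp_apply)
  moreover have "D (L (J x)) = J x" for x
  proof -
    obtain y where "J x = D y" using J(2) by blast
    then show ?thesis using L(2) by (metis comp_apply id_apply)
  qed
  ultimately have DE: "D (E *v x) = J x" for x by simp
  define g :: "real^'m^'m" where "g = (\<chi> i j. D (axis i 1) \<bullet> D (axis j 1))"
  have g: "y \<bullet> (g *v x) = D y \<bullet> D x" for x y
    unfolding g_def by (rule inner_bilinear_form_matrix)
      (auto intro!: linearI simp: linear_add[OF assms(1)] linear_cmul[OF assms(1)] inner_add_left inner_add_right)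
  have "y \<bullet> ((transpose E ** g ** E) *v x) = y \<bullet> (mat 1 *v x)" for x y
  proof -
    have "y \<bullet> ((transpose E ** g ** E) *v x) = y \<bullet> x"
      unfolding inner_matrix_congruence by (simp add: g DE Jin)
    then show ?thesis by simp
  qed
  then have "(transpose E ** g) ** E = mat 1"
    unfolding matrix_eq using vector_eq_ldot by blast
  then have "E ** (transpose E ** g) = mat 1"
    by (simp only: matrix_left_right_inverse)
  then have "g ** (E ** transpose E) = mat 1"
    by (metis matrix_left_right_inverse matrix_mul_assoc)
  then have "matrix_inv g = E ** transpose E" by (rule matrix_inv_eqI)
  then show thesis using that[OF J(1,2) Jin DE] g_def by blast
qed

text \<open>
  The orthogonal complement of \<open>range D\<close> is a plane containing the position vector \<open>z\<close>; \<open>\<nu>\<close> is the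
  unit vector of that plane orthogonal to \<open>z\<close>, hence normal to the hypersurface inside the
  sphere.
\<close>

lemma unit_normal_in_codimension_two:
  fixes D :: "real^'m \<Rightarrow> 'e::euclidean_space"
  assumes D: "linear D" "inj D" and z: "z \<noteq> 0" "\<And>v. z \<bullet> D v = 0"
    and dim: "CARD('m) + 2 = DIM('e)"
  obtains \<nu> where "norm \<nu> = 1" "{w. w \<bullet> z = 0 \<and> (\<forall>i. w \<bullet> D (axis i 1) = 0)} = span {\<nu>}"
    "range D = {w. w \<bullet> z = 0 \<and> w \<bullet> \<nu> = 0}"
proof -
  define T where "T = insert z (range D)"
  have sub: "subspace (range D)" using D(1) by (simp add: linear_subspace_image)
  have "dim (range D) = dim (UNIV :: (real^'m) set)"
    by (rule dim_image_eq) (use D in auto)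
  moreover have "z \<notin> range D" using z by (metis imageE inner_eq_zero_iff)
  ultimately have "dim T = DIM('e) - 1"
    using dim sub by (simp add: T_def dim_insert span_eq_iff[THEN iffD2])
  then obtain a where a: "a \<noteq> 0" "span T = {x. a \<bullet> x = 0}" by (rule lowdim_eq_hyperplane)
  define \<nu> where "\<nu> = a /\<^sub>R norm a"
  have n: "norm \<nu> = 1" using a by (simp add: \<nu>_def)
  then have nn: "\<nu> \<bullet> \<nu> = 1" by (simp add: norm_eq_1)
  have T: "span T = {x. \<nu> \<bullet> x = 0}" using a by (simp add: \<nu>_def)
  have Tz: "\<nu> \<bullet> z = 0" and TD: "\<nu> \<bullet> D v = 0" for v
    using T span_base[of _ T] by (auto simp: T_def)
  have "w \<in> span {\<nu>}" if w: "w \<bullet> z = 0" "\<And>i. w \<bullet> D (axis i 1) = 0" for w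
  proof -
    have "w \<bullet> D v = 0" for v
    proof -
      have "D v = D (\<Sum>i\<in>UNIV. v $ i *\<^sub>R axis i 1)"
        using basis_expansion[of v] by (simp add: scalar_mult_eq_scaleR)
      then show ?thesis by (simp add: linear_sum[OF D(1)] linear_cmul[OF D(1)] inner_sum_right w)
    qed
    then have "span T \<subseteq> {y. w \<bullet> y = 0}"
      using w(1) by (intro span_minimal subspace_hyperplane) (auto simp: T_def)
    moreover have "w - (w \<bullet> \<nu>) *\<^sub>R \<nu> \<in> span T"
      by (simp add: T inner_diff_right nn inner_commute)
    ultimately have "w \<bullet> (w - (w \<bullet> \<nu>) *\<^sub>R \<nu>) = 0" by auto
    then have "(w - (w \<bullet> \<nu>) *\<^sub>R \<nu>) \<bullet> (w - (w \<bullet> \<nu>) *\<^sub>R \<nu>) = 0"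
      using nn by (simp add: inner_diff_left inner_diff_right inner_commute)
    then have "w = (w \<bullet> \<nu>) *\<^sub>R \<nu>" by simp
    then show ?thesis by (metis span_base span_mul singletonI)
  qed
  moreover have "w \<bullet> z = 0 \<and> (\<forall>i. w \<bullet> D (axis i 1) = 0)" if "w \<in> span {\<nu>}" for w
    using that Tz TD by (auto simp: span_singleton)
  ultimately have N: "{w. w \<bullet> z = 0 \<and> (\<forall>i. w \<bullet> D (axis i 1) = 0)} = span {\<nu>}" by blast
  have "w \<in> range D" if w: "w \<bullet> z = 0" "w \<bullet> \<nu> = 0" for w
  proof -
    have "w \<in> span (insert z (range D))" using T w by (simp add: T_def inner_commute)
    then obtain k where "w - k *\<^sub>R z \<in> range D"
      unfolding span_insert using sub by (auto simp: span_eq_iff[THEN iffD2])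
    moreover from this have "(w - k *\<^sub>R z) \<bullet> z = 0" using z(2) by (auto simp: inner_commute)
    then have "k = 0" using w z(1) by (simp add: inner_diff_left)
    ultimately show ?thesis by simp
  qed
  then have "range D = {w. w \<bullet> z = 0 \<and> w \<bullet> \<nu> = 0}"
    using z(2) TD by (auto simp: inner_commute)
  then show thesis using that n N by blast
qed

lemma orth_proj_span_unit:
  assumes "norm \<nu> = 1"
  shows "orth_proj (span {\<nu>}) v = (v \<bullet> \<nu>) *\<^sub>R \<nu>"
  unfolding orth_proj_def
proof (rule the_equality)
  have nn: "\<nu> \<bullet> \<nu> = 1" using assms by (simp add: norm_eq_1)
  then show "(v \<bullet> \<nu>) *\<^sub>R \<nu> \<in> span {\<nu>} \<and> (\<forall>y\<in>span {\<nu>}. (v - (v \<bullet> \<nu>) *\<^sub>R \<nu>) \<bullet> y = 0)"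
    by (auto simp: span_singleton inner_diff_left)
  show "w = (v \<bullet> \<nu>) *\<^sub>R \<nu>" if w: "w \<in> span {\<nu>} \<and> (\<forall>y\<in>span {\<nu>}. (v - w) \<bullet> y = 0)" for w
  proof -
    obtain r where r: "w = r *\<^sub>R \<nu>" using w by (auto simp: span_singleton)
    have "(v - w) \<bullet> \<nu> = 0" using w span_base by blast
    then show ?thesis using nn by (simp add: r inner_diff_left)
  qed
qed

text \<open>
  With \<open>G = E E\<^sup>T\<close> for the inverse metric, contracting the scalar second fundamental form \<open>h\<close> with
  two copies of \<open>G\<close> is \<open>h \<bullet> (G h G)\<close>, and adjointness distributes the factors of \<open>G\<close> evenly over
  both arguments.  So in the frame \<open>E\<close> the norm of \<open>A\<close> is the plain Frobenius norm and the mean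
  curvature is the plain trace of one matrix \<open>B\<close>.
\<close>

lemma curvature_in_orthonormal_frame:
  fixes f :: "real^'m \<Rightarrow> 'e::euclidean_space"
  assumes N: "normal_space f u = span {\<nu>}" "norm \<nu> = 1"
    and G: "matrix_inv (metric f u) = E ** transpose E"
    and B: "B = transpose E ** (\<chi> i j. \<nu> \<bullet> pd i (pd j f) u) ** E"
  shows "norm_A_sq f u = B \<bullet> B" "(norm (mean_curvature f u))\<^sup>2 = (trace B)\<^sup>2"
proof -
  define h :: "real^'m^'m" where "h = (\<chi> i j. \<nu> \<bullet> pd i (pd j f) u)"
  define G where "G = E ** transpose E"
  have nn: "\<nu> \<bullet> \<nu> = 1" using N(2) by (simp add: norm_eq_1)
  have A: "second_ff f u i j = h $ i $ j *\<^sub>R \<nu>" for i j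
    unfolding second_ff_def N(1) orth_proj_span_unit[OF N(2)] by (simp add: h_def inner_commute)
  have "norm_A_sq f u = (\<Sum>i\<in>UNIV. \<Sum>j\<in>UNIV. \<Sum>k\<in>UNIV. \<Sum>l\<in>UNIV. G $ i $ k * G $ j $ l * (h $ i $ j * h $ k $ l))"
    by (simp add: norm_A_sq_def A nn assms(3) G_def Let_def mult_ac)
  also have "\<dots> = (\<Sum>i\<in>UNIV. \<Sum>j\<in>UNIV. h $ i $ j * (\<Sum>l\<in>UNIV. (\<Sum>k\<in>UNIV. G $ i $ k * h $ k $ l) * G $ j $ l))"
  proof (intro sum.cong refl)
    fix i j
    show "(\<Sum>k\<in>UNIV. \<Sum>l\<in>UNIV. G $ i $ k * G $ j $ l * (h $ i $ j * h $ k $ l))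
      = h $ i $ j * (\<Sum>l\<in>UNIV. (\<Sum>k\<in>UNIV. G $ i $ k * h $ k $ l) * G $ j $ l)"
      by (subst sum.swap) (simp add: sum_distrib_left sum_distrib_right mult_ac)
  qed
  also have "\<dots> = h \<bullet> (G ** h ** transpose G)"
    by (simp add: inner_vec_def matrix_matrix_mult_def transpose_def)
  also have "\<dots> = h \<bullet> (E ** (transpose E ** h ** E ** transpose E))"
    by (simp add: G_def matrix_transpose_mul matrix_mul_assoc)
  also have "\<dots> = (transpose E ** h) \<bullet> ((transpose E ** h ** E) ** transpose E)"
    by (simp add: inner_matrix_mult_right)
  also have "\<dots> = B \<bullet> B"
    by (simp add: inner_matrix_mult_left B h_def)
  finally show "norm_A_sq f u = B \<bullet> B" .
  have "mean_curvature f u = (G \<bullet> h) *\<^sub>R \<nu>"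
    by (simp add: mean_curvature_def A assms(3) G_def[symmetric] Let_def scaleR_sum_left inner_vec_def)
  moreover have "G \<bullet> h = trace B"
    unfolding G_def B h_def[symmetric]
    by (metis inner_commute inner_mat_1 inner_matrix_mult_left inner_matrix_mult_right matrix_mul_assoc matrix_mul_lid matrix_mul_rid transpose_transpose)
  ultimately show "(norm (mean_curvature f u))\<^sup>2 = (trace B)\<^sup>2"
    by (simp add: N(2))
qed


section \<open>Symmetry of second derivatives\<close>

text \<open>
  The mean value theorem, applied to \<open>r \<mapsto> f (u + r x + s y) - f (u + r x)\<close> on \<open>[0, s]\<close>, expresses
  the second difference through two values of the derivative in direction \<open>x\<close>; differentiability of
  that derivative at the single point \<open>u\<close> evaluates them up to \<open>o(s)\<close>.
\<close>

lemma second_order_quotient_tendsto: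
  fixes f :: "'a::real_normed_vector \<Rightarrow> real"
  assumes S: "open S" "u \<in> S"
    and f: "\<And>z. z \<in> S \<Longrightarrow> (f has_derivative f' z) (at z)"
    and f'x: "((\<lambda>z. f' z x) has_derivative A) (at u)"
  shows "((\<lambda>s. (f (u + s *\<^sub>R x + s *\<^sub>R y) - f (u + s *\<^sub>R x) - f (u + s *\<^sub>R y) + f u) / s\<^sup>2) \<longlongrightarrow> A y)
    (at_right 0)"
proof (rule tendstoI)
  fix e :: real assume "e > 0"
  define K where "K = norm x + norm y + 1"
  have K: "K > 0" unfolding K_def by (smt (verit) norm_ge_zero)
  define e' where "e' = e / (4 * K)"
  have e': "e' > 0" using \<open>e > 0\<close> K by (simp add: e'_def)
  interpret A: bounded_linear A using f'x by (rule has_derivative_bounded_linear)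
  obtain d1 where d1: "d1 > 0" "\<And>z. norm (z - u) < d1 \<Longrightarrow> norm (f' z x - f' u x - A (z - u)) \<le> e' * norm (z - u)"
    using f'x e' unfolding has_derivative_at_alt by meson
  obtain d2 where d2: "d2 > 0" "\<And>z. norm (z - u) < d2 \<Longrightarrow> z \<in> S"
    using S unfolding open_dist dist_norm by blast
  define d where "d = min d1 d2 / K"
  have "d > 0" using d1 d2 K by (simp add: d_def)
  have "dist ((f (u + s *\<^sub>R x + s *\<^sub>R y) - f (u + s *\<^sub>R x) - f (u + s *\<^sub>R y) + f u) / s\<^sup>2) (A y) < e"
    if s: "0 < s" "s < d" for s
  proof -
    have sK: "s * K < min d1 d2" using s K by (simp add: d_def field_simps)
    have small: "norm (r *\<^sub>R x + q *\<^sub>R y) \<le> s * K" if "0 \<le> r" "r \<le> s" "0 \<le> q" "q \<le> s" for r q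
    proof -
      have "norm (r *\<^sub>R x + q *\<^sub>R y) \<le> r * norm x + q * norm y"
        using that by (metis norm_triangle_ineq norm_scaleR abs_of_nonneg)
      also have "\<dots> \<le> s * norm x + s * norm y"
        using that by (intro add_mono mult_right_mono) auto
      also have "\<dots> \<le> s * K" using s by (simp add: K_def algebra_simps)
      finally show ?thesis .
    qed
    have inS: "u + (r *\<^sub>R x + q *\<^sub>R y) \<in> S" if "0 \<le> r" "r \<le> s" "0 \<le> q" "q \<le> s" for r q
      by (rule d2(2)) (use small[OF that] sK in simp)
    define G where "G = (\<lambda>r. f (u + (r *\<^sub>R x + s *\<^sub>R y)) - f (u + (r *\<^sub>R x + 0 *\<^sub>R y)))"
    have G': "(G has_derivative (\<lambda>h. f' (u + (r *\<^sub>R x + s *\<^sub>R y)) (h *\<^sub>R x) - f' (u + (r *\<^sub>R x + 0 *\<^sub>R y)) (h *\<^sub>R x))) (at r)"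
      if "0 \<le> r" "r \<le> s" for r
      unfolding G_def
      by (intro has_derivative_diff; rule has_derivative_compose[where g = f])
         (use that s inS[of r 0] in \<open>auto intro!: derivative_eq_intros f inS\<close>)
    have "\<exists>r\<in>{0<..<s}. G s - G 0 = (\<lambda>h. f' (u + (r *\<^sub>R x + s *\<^sub>R y)) (h *\<^sub>R x) - f' (u + (r *\<^sub>R x + 0 *\<^sub>R y)) (h *\<^sub>R x)) (s - 0)"
      by (rule mvt_simple) (use s G' in \<open>auto intro: has_derivative_at_withinI\<close>)
    then obtain r where r: "0 < r" "r < s" and Gs: "G s - G 0 = f' (u + (r *\<^sub>R x + s *\<^sub>R y)) (s *\<^sub>R x) - f' (u + (r *\<^sub>R x + 0 *\<^sub>R y)) (s *\<^sub>R x)"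
      by auto
    have lin: "f' z (s *\<^sub>R x) = s * f' z x" if "z \<in> S" for z
      using linear_cmul[OF has_derivative_linear[OF f[OF that]]] by simp
    have est: "\<bar>f' (u + (r *\<^sub>R x + q *\<^sub>R y)) x - f' u x - A (r *\<^sub>R x + q *\<^sub>R y)\<bar> \<le> e' * (s * K)" if "0 \<le> q" "q \<le> s" for q
    proof -
      have "norm (r *\<^sub>R x + q *\<^sub>R y) \<le> s * K" using small r that by simp
      then show ?thesis
        using d1(2)[of "u + (r *\<^sub>R x + q *\<^sub>R y)"] sK e'
        by (smt (verit) add_diff_cancel_left' mult_left_mono real_norm_def)
    qed
    define \<Delta> where "\<Delta> = G s - G 0"
    have "\<Delta> = s * (f' (u + (r *\<^sub>R x + s *\<^sub>R y)) x - f' (u + (r *\<^sub>R x + 0 *\<^sub>R y)) x)"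
      unfolding \<Delta>_def Gs using r s by (simp add: lin inS[of r s, simplified] inS[of r 0, simplified] right_diff_distrib)
    then have "\<Delta> - s\<^sup>2 * A y = s * ((f' (u + (r *\<^sub>R x + s *\<^sub>R y)) x - f' u x - A (r *\<^sub>R x + s *\<^sub>R y))
        - (f' (u + (r *\<^sub>R x + 0 *\<^sub>R y)) x - f' u x - A (r *\<^sub>R x + 0 *\<^sub>R y)))"
      by (simp add: A.add A.scaleR algebra_simps power2_eq_square)
    also have "\<bar>\<dots>\<bar> \<le> s * (2 * (e' * (s * K)))"
      unfolding abs_mult using est[of s] est[of 0] s by (intro mult_mono) auto
    also have "\<dots> = s\<^sup>2 * (e / 2)" using K by (simp add: e'_def power2_eq_square)
    finally have "\<bar>\<Delta> - s\<^sup>2 * A y\<bar> \<le> s\<^sup>2 * (e / 2)" .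
    then have "\<bar>\<Delta> / s\<^sup>2 - A y\<bar> \<le> e / 2"
      using s by (simp add: abs_le_iff field_simps)
    moreover have "\<Delta> = f (u + s *\<^sub>R x + s *\<^sub>R y) - f (u + s *\<^sub>R x) - f (u + s *\<^sub>R y) + f u"
      by (simp add: \<Delta>_def G_def algebra_simps)
    ultimately show ?thesis using \<open>e > 0\<close> by (simp add: dist_real_def)
  qed
  then show "\<forall>\<^sub>F s in at_right 0. dist ((f (u + s *\<^sub>R x + s *\<^sub>R y) - f (u + s *\<^sub>R x) - f (u + s *\<^sub>R y) + f u) / s\<^sup>2) (A y) < e"
    unfolding eventually_at_right_field using \<open>d > 0\<close> by (intro exI[of _ d]) auto
qed

text \<open>
  The second difference quotient is symmetric in the two directions and tends to either of the two
  iterated derivatives.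
\<close>

lemma second_derivative_symmetric:
  fixes f :: "'a::real_normed_vector \<Rightarrow> 'b::euclidean_space"
  assumes S: "open S" "u \<in> S"
    and f: "\<And>z. z \<in> S \<Longrightarrow> (f has_derivative f' z) (at z)"
    and f': "\<And>v. ((\<lambda>z. f' z v) has_derivative (\<lambda>y. f'' y v)) (at u)"
  shows "f'' x y = f'' y x"
proof (rule vector_eq_rdot[THEN iffD1], intro allI)
  fix w
  have q: "((\<lambda>s. (f (u + s *\<^sub>R x + s *\<^sub>R y) \<bullet> w - f (u + s *\<^sub>R x) \<bullet> w - f (u + s *\<^sub>R y) \<bullet> w + f u \<bullet> w) / s\<^sup>2)
      \<longlongrightarrow> f'' y x \<bullet> w) (at_right 0)" for x y
    by (rule second_order_quotient_tendsto[OF S, where f = "\<lambda>z. f z \<bullet> w" and f' = "\<lambda>z v. f' z v \<bullet> w"])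
       (auto intro!: derivative_eq_intros f f')
  have "((\<lambda>s. (f (u + s *\<^sub>R x + s *\<^sub>R y) \<bullet> w - f (u + s *\<^sub>R x) \<bullet> w - f (u + s *\<^sub>R y) \<bullet> w + f u \<bullet> w) / s\<^sup>2)
      \<longlongrightarrow> f'' x y \<bullet> w) (at_right 0)"
    using q[of y x] by (simp add: algebra_simps)
  then show "f'' x y \<bullet> w = f'' y x \<bullet> w"
    using q[of x y] tendsto_unique trivial_limit_at_right_real by blast
qed


section \<open>Smooth immersions\<close>

lemma Ck_on_subset: "Ck_on k S f \<Longrightarrow> T \<subseteq> S \<Longrightarrow> Ck_on k T f"
  by (induction k arbitrary: f) (auto intro: continuous_on_subset)

lemma smooth_on_subset: "smooth_on S f \<Longrightarrow> T \<subseteq> S \<Longrightarrow> smooth_on T f"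
  unfolding smooth_on_def using Ck_on_subset by blast

lemma smooth_on_imp_has_derivative:
  assumes "smooth_on S f" "u \<in> S"
  shows "(f has_derivative frechet_derivative f (at u)) (at u)"
proof -
  have "Ck_on (Suc 0) S f" using assms(1) unfolding smooth_on_def by blast
  then show ?thesis using assms(2) frechet_derivative_works by auto
qed

lemma smooth_on_imp_continuous_on: "smooth_on S f \<Longrightarrow> continuous_on S f"
  unfolding smooth_on_def using Ck_on.simps(1) by blast

lemma isCont_tendsto_nhds: "isCont f u \<Longrightarrow> (f \<longlongrightarrow> f u) (nhds u)"
  unfolding isCont_def by (rule tendsto_at_iff_tendsto_nhds[THEN iffD1])

text \<open>
  In finite dimension, strong continuity of a family of linear maps at a point is continuity in
  operator norm.
\<close>

lemma eventually_derivative_close: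
  fixes f' :: "'a::metric_space \<Rightarrow> real^'m \<Rightarrow> 'e::euclidean_space"
  assumes lin: "\<forall>\<^sub>F z in nhds u. linear (f' z)"
    and cont: "\<And>v. isCont (\<lambda>z. f' z v) u"
    and "e > 0"
  shows "\<forall>\<^sub>F z in nhds u. \<forall>v. norm (f' z v - f' u v) \<le> e * norm v"
proof -
  have "isCont (\<lambda>z. \<Sum>i\<in>UNIV. norm (f' z (axis i 1) - f' u (axis i 1))) u"
    by (intro continuous_intros cont)
  then have "((\<lambda>z. \<Sum>i\<in>UNIV. norm (f' z (axis i 1) - f' u (axis i 1))) \<longlongrightarrow> 0) (nhds u)"
    using isCont_tendsto_nhds by fastforce
  then have small: "\<forall>\<^sub>F z in nhds u. (\<Sum>i\<in>UNIV. norm (f' z (axis i 1) - f' u (axis i 1))) < e"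
    using order_tendstoD(2) \<open>e > 0\<close> by blast
  have "linear (f' u)" using lin eventually_nhds_x_imp_x by blast
  show ?thesis
    using lin small
  proof eventually_elim
    case (elim z)
    have "norm (f' z v - f' u v) \<le> e * norm v" for v
    proof -
      define g where "g = (\<lambda>v. f' z v - f' u v)"
      have g: "linear g" unfolding g_def using elim(1) \<open>linear (f' u)\<close> by (rule linear_compose_sub)
      have "g v = g (\<Sum>i\<in>UNIV. v $ i *\<^sub>R axis i 1)"
        using basis_expansion[of v] by (simp add: scalar_mult_eq_scaleR)
      also have "\<dots> = (\<Sum>i\<in>UNIV. v $ i *\<^sub>R g (axis i 1))"
        by (simp add: linear_sum[OF g] linear_cmul[OF g])
      also have "norm \<dots> \<le> (\<Sum>i\<in>UNIV. norm v * norm (g (axis i 1)))"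
        by (rule sum_norm_le) (simp add: mult_right_mono component_le_norm_cart)
      also have "\<dots> \<le> e * norm v"
        using mult_left_mono[OF less_imp_le[OF elim(2)] norm_ge_zero[of v]]
        by (simp add: sum_distrib_left g_def mult.commute)
      finally show ?thesis by (simp add: g_def)
    qed
    then show ?case by blast
  qed
qed

lemma immersion_locally_injective:
  fixes f :: "real^'m \<Rightarrow> 'e::euclidean_space"
  assumes S: "open S" "u \<in> S" and f: "smooth_on S f" and inj: "inj (frechet_derivative f (at u))"
  obtains r where "r > 0" "cball u r \<subseteq> S" "inj_on f (cball u r)"
proof -
  define f' where "f' = (\<lambda>z. frechet_derivative f (at z))"
  have der: "(f has_derivative f' z) (at z)" if "z \<in> S" for z
    unfolding f'_def using f that by (rule smooth_on_imp_has_derivative)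
  have "linear (f' u)" using der S(2) has_derivative_linear by blast
  then obtain L where L: "linear L" "L \<circ> f' u = id"
    using linear_injective_left_inverse inj f'_def by metis
  have "Ck_on (Suc 0) S f" using f unfolding smooth_on_def by blast
  then have cont: "isCont (\<lambda>z. f' z v) u" for v
    using S by (simp add: f'_def continuous_on_eq_continuous_at)
  have lin: "\<forall>\<^sub>F z in nhds u. linear (f' z)"
    using eventually_nhds_in_open[OF S] by eventually_elim (use der has_derivative_linear in blast)
  have close: "\<exists>d>0. \<forall>x. dist u x < d \<longrightarrow> onorm (\<lambda>v. f' x v - f' u v) < e" if "e > 0" for e
  proof -
    have "\<forall>\<^sub>F z in nhds u. \<forall>v. norm (f' z v - f' u v) \<le> e / 2 * norm v"
      by (rule eventually_derivative_close[OF lin cont]) (use \<open>e > 0\<close> in simp)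
    then obtain d where d: "d > 0" "\<And>z v. dist z u < d \<Longrightarrow> norm (f' z v - f' u v) \<le> e / 2 * norm v"
      unfolding eventually_nhds_metric by blast
    have "onorm (\<lambda>v. f' x v - f' u v) < e" if "dist u x < d" for x
    proof -
      have "onorm (\<lambda>v. f' x v - f' u v) \<le> e / 2"
        using d(2)[of x] that \<open>e > 0\<close> by (intro onorm_bound) (auto simp: dist_commute)
      then show ?thesis using \<open>e > 0\<close> by simp
    qed
    then show ?thesis using d(1) by blast
  qed
  have "bounded_linear L" using L(1) by (simp add: linear_conv_bounded_linear)
  then obtain r where r: "r > 0" "ball u r \<subseteq> S" "inj_on f (ball u r)"
    by (rule has_derivative_locally_injective[where f = f and f' = f', OF S(2,1) _ L(2) der close])
  show thesis
  proof (rule that[of "r / 2"])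
    show "cball u (r / 2) \<subseteq> S" "inj_on f (cball u (r / 2))"
      using r by (auto intro: inj_on_subset simp: subset_iff)
  qed (use r in simp)
qed

text \<open>
  Relative to \<open>f ` K\<close> the inverse of \<open>f\<close> is continuous by compactness and therefore differentiable
  at \<open>f u\<close>.  So the curve pulls back to a curve in the domain that is differentiable at \<open>0\<close>, and \<open>D\<close>
  maps its velocity to \<open>v\<close>.
\<close>

lemma vector_in_range_of_curve_in_image:
  fixes f :: "'a::euclidean_space \<Rightarrow> 'b::euclidean_space"
  assumes f: "(f has_derivative D) (at u)" "inj D"
    and K: "compact K" "continuous_on K f" "inj_on f K" "u \<in> K"
    and \<gamma>: "(\<gamma> has_vector_derivative v) (at 0)" "\<gamma> 0 = f u" "\<forall>\<^sub>F t in nhds (0::real). \<gamma> t \<in> f ` K"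
  shows "v \<in> range D"
proof -
  have linD: "linear D" using f(1) by (rule has_derivative_linear)
  obtain L where L: "linear L" "L \<circ> D = id" using linear_injective_left_inverse[OF linD f(2)] by blast
  define g where "g = inv_into K f"
  have gf: "g (f x) = x" if "x \<in> K" for x using that K(3) by (simp add: g_def)
  have "continuous_on (f ` K) g" by (rule continuous_on_inv[OF K(2,1)]) (simp add: gf)
  then have "continuous (at (f u) within f ` K) g" using K(4) by (simp add: continuous_on_eq_continuous_within)
  then have g: "(g has_derivative L) (at (f u) within f ` K)"
    by (intro has_derivative_inverse_within[OF has_derivative_at_withinI[OF f(1)] _ K(4) L gf])
  obtain T where T: "open T" "0 \<in> T" "\<And>t. t \<in> T \<Longrightarrow> \<gamma> t \<in> f ` K"
    using \<gamma>(3) unfolding eventually_nhds by blast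
  have \<gamma>': "(\<gamma> has_derivative (\<lambda>t. t *\<^sub>R v)) (at 0 within T)"
    using \<gamma>(1) unfolding has_vector_derivative_def by (rule has_derivative_at_withinI)
  have "((\<lambda>t. g (\<gamma> t)) has_derivative (\<lambda>t. L (t *\<^sub>R v))) (at 0 within T)"
    by (rule has_derivative_in_compose[OF \<gamma>' has_derivative_subset[OF g[folded \<gamma>(2)]]])
       (use T(3) in auto)
  then have "((\<lambda>t. f (g (\<gamma> t))) has_derivative (\<lambda>t. D (L (t *\<^sub>R v)))) (at 0 within T)"
    by (rule has_derivative_compose) (simp add: \<gamma>(2) gf K(4) f(1))
  then have "(\<gamma> has_derivative (\<lambda>t. D (L (t *\<^sub>R v)))) (at 0 within T)"
    by (rule has_derivative_transform[rotated 2]) (use T gf in force)+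
  then have "(\<gamma> has_derivative (\<lambda>t. D (L (t *\<^sub>R v)))) (at 0)" 
    using T at_within_open by metis
  then have "(\<lambda>t. D (L (t *\<^sub>R v))) = (\<lambda>t. t *\<^sub>R v)"
    using \<gamma>(1) unfolding has_vector_derivative_def by (rule has_derivative_unique)
  then have "D (L (1 *\<^sub>R v)) = 1 *\<^sub>R v" by meson
  then show ?thesis by (metis rangeI scaleR_one)
qed


section \<open>Differentiating a tangent field\<close>

text \<open>
  The coefficients of a continuous tangent field in a moving frame are continuous: \<open>f' u\<close> is bounded
  below, hence so is \<open>f' z\<close> with half the bound for \<open>z\<close> near \<open>u\<close>, and \<open>f' z\<close> maps
  \<open>X z - X u\<close> to \<open>g z - f' z (X u)\<close>, which tends to \<open>0\<close>.
\<close>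

lemma isCont_coefficients:
  fixes f' :: "'a::metric_space \<Rightarrow> real^'m \<Rightarrow> 'e::euclidean_space"
  assumes lin: "\<forall>\<^sub>F z in nhds u. linear (f' z)"
    and cont: "\<And>v. isCont (\<lambda>z. f' z v) u"
    and inj: "inj (f' u)"
    and g: "isCont g u" "\<forall>\<^sub>F z in nhds u. f' z (X z) = g z"
  shows "isCont X u"
proof -
  have lu: "linear (f' u)" using lin eventually_nhds_x_imp_x by blast
  have gu: "f' u (X u) = g u" using g(2) eventually_nhds_x_imp_x by blast
  obtain b where b: "b > 0" "\<And>x. b * norm x \<le> norm (f' u x)"
    using linear_inj_bounded_below_pos[OF lu inj] by blast
  have close: "\<forall>\<^sub>F z in nhds u. \<forall>v. norm (f' z v - f' u v) \<le> b / 2 * norm v"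
    by (rule eventually_derivative_close[OF lin cont]) (use b(1) in simp)
  have "\<forall>\<^sub>F z in nhds u. norm (X z - X u) \<le> norm (g z - f' z (X u)) * (2 / b)"
    using lin g(2) close
  proof eventually_elim
    case (elim z)
    have "b * norm (X z - X u) \<le> norm (f' u (X z - X u))" by (rule b(2))
    also have "\<dots> \<le> norm (f' z (X z - X u)) + norm (f' z (X z - X u) - f' u (X z - X u))"
      by norm
    also have "\<dots> \<le> norm (g z - f' z (X u)) + b / 2 * norm (X z - X u)"
    proof (intro add_mono)
      show "norm (f' z (X z - X u)) \<le> norm (g z - f' z (X u))"
        using elim(1,2) by (simp add: linear_diff)
      show "norm (f' z (X z - X u) - f' u (X z - X u)) \<le> b / 2 * norm (X z - X u)"
        using elim(3) by blast
    qed
    finally show ?case using b(1) by (simp add: field_simps)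
  qed
  moreover have "((\<lambda>z. norm (g z - f' z (X u)) * (2 / b)) \<longlongrightarrow> 0) (nhds u)"
  proof -
    have "isCont (\<lambda>z. norm (g z - f' z (X u)) * (2 / b)) u"
      by (intro continuous_intros cont g)
    from isCont_tendsto_nhds[OF this] show ?thesis by (simp add: gu)
  qed
  ultimately have "((\<lambda>z. X z - X u) \<longlongrightarrow> 0) (nhds u)"
    by (rule Lim_null_comparison)
  then show ?thesis
    unfolding isCont_def tendsto_at_iff_tendsto_nhds by (subst Lim_null)
qed

text \<open>
  The product rule at a zero of one factor asks only for continuity of the other factor.
\<close>

lemma DERIV_mult_vanishing:
  fixes X a :: "real \<Rightarrow> real"
  assumes "isCont X 0" "a 0 = 0" "DERIV a 0 :> a'"
  shows "DERIV (\<lambda>t. X t * a t) 0 :> X 0 * a'"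
proof -
  have "((\<lambda>h. X h * (a h / h)) \<longlongrightarrow> X 0 * a') (at 0)"
    using assms by (intro tendsto_mult) (auto simp: continuous_at DERIV_def)
  then show ?thesis by (simp add: DERIV_def assms(2))
qed

text \<open>
  The Gauss formula for a tangent field \<open>g = Df(X)\<close>: the normal component of its derivative is the
  second fundamental form.  Formally \<open>\<partial>\<^sub>y g = D\<^sup>2f(y, X) + Df(\<partial>\<^sub>y X)\<close> with the last term
  tangent.  No derivative of \<open>X\<close> appears in the result, and continuity of \<open>X\<close> suffices, because each
  coefficient of \<open>X\<close> multiplies a function \<open>\<langle>\<nu>, f' z (e\<^sub>i)\<rangle>\<close> vanishing at \<open>u\<close>.
\<close>

lemma normal_derivative_of_tangent_field:
  fixes f' :: "real^'m \<Rightarrow> real^'m \<Rightarrow> 'e::euclidean_space"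
  assumes lin: "\<forall>\<^sub>F z in nhds u. linear (f' z)"
    and f': "\<And>v. ((\<lambda>z. f' z v) has_derivative (\<lambda>y. f'' y v)) (at u)"
    and lin2: "linear (f'' y)"
    and inj: "inj (f' u)"
    and \<nu>: "\<And>v. \<nu> \<bullet> f' u v = 0"
    and g: "(g has_derivative g') (at u)" "\<forall>\<^sub>F z in nhds u. f' z (X z) = g z"
  shows "\<nu> \<bullet> f'' y (X u) = \<nu> \<bullet> g' y"
proof -
  have contX: "isCont X u"
    by (rule isCont_coefficients[OF lin _ inj _ g(2)]) (use f' g(1) has_derivative_continuous in blast)+
  define l where "l = (\<lambda>t::real. u + t *\<^sub>R y)"
  have l0: "l 0 = u" by (simp add: l_def)
  have l: "(l has_derivative (\<lambda>t. t *\<^sub>R y)) (at 0)"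
    unfolding l_def by (auto intro!: derivative_eq_intros)
  have lcont: "filterlim l (nhds u) (nhds 0)"
    using isCont_tendsto_nhds[OF has_derivative_continuous[OF l]] by (simp add: l0)
  have expand: "v = (\<Sum>i\<in>UNIV. v $ i *\<^sub>R axis i 1)" for v :: "real^'m"
    using basis_expansion[of v] by (simp add: scalar_mult_eq_scaleR)
  have ev: "\<forall>\<^sub>F t in nhds 0. (\<Sum>i\<in>UNIV. X (l t) $ i * (\<nu> \<bullet> f' (l t) (axis i 1))) = \<nu> \<bullet> g (l t)"
    using eventually_compose_filterlim[OF eventually_conj[OF lin g(2)] lcont]
  proof eventually_elim
    case (elim t)
    have "\<nu> \<bullet> g (l t) = \<nu> \<bullet> f' (l t) (\<Sum>i\<in>UNIV. X (l t) $ i *\<^sub>R axis i 1)"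
      using elim expand[of "X (l t)"] by simp
    then show ?case using elim
      by (simp add: linear_sum linear_cmul inner_sum_right)
  qed
  have "((\<lambda>t. \<nu> \<bullet> f' (l t) v) has_derivative (\<lambda>t. \<nu> \<bullet> f'' (t *\<^sub>R y) v)) (at 0)" for v
    using has_derivative_compose[OF l, of "\<lambda>z. \<nu> \<bullet> f' z v" "\<lambda>y. \<nu> \<bullet> f'' y v"] f'[of v]
    by (simp add: l0 has_derivative_inner_right)
  moreover have "f'' (t *\<^sub>R y) v = t *\<^sub>R f'' y v" for t v
    using linear_cmul[OF has_derivative_linear[OF f']] by simp
  ultimately have "DERIV (\<lambda>t. \<nu> \<bullet> f' (l t) v) 0 :> \<nu> \<bullet> f'' y v" for v
    by (simp add: has_field_derivative_def mult_commute_abs)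
  moreover have "isCont (\<lambda>t. X (l t) $ i) 0" for i
    using isCont_o2[OF has_derivative_continuous[OF l]] contX
    by (intro continuous_intros) (simp add: l0)
  ultimately have "DERIV (\<lambda>t. X (l t) $ i * (\<nu> \<bullet> f' (l t) (axis i 1))) 0 :> X u $ i * (\<nu> \<bullet> f'' y (axis i 1))" for i
    using DERIV_mult_vanishing[of "\<lambda>t. X (l t) $ i" "\<lambda>t. \<nu> \<bullet> f' (l t) (axis i 1)"] by (simp add: l0 \<nu>)
  then have "DERIV (\<lambda>t. \<Sum>i\<in>UNIV. X (l t) $ i * (\<nu> \<bullet> f' (l t) (axis i 1))) 0 :> (\<Sum>i\<in>UNIV. X u $ i * (\<nu> \<bullet> f'' y (axis i 1)))"
    by (intro DERIV_sum) auto
  then have "DERIV (\<lambda>t. \<nu> \<bullet> g (l t)) 0 :> (\<Sum>i\<in>UNIV. X u $ i * (\<nu> \<bullet> f'' y (axis i 1)))"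
    using DERIV_cong_ev[OF refl ev refl] by simp
  moreover have "DERIV (\<lambda>t. \<nu> \<bullet> g (l t)) 0 :> \<nu> \<bullet> g' y"
  proof -
    have "((\<lambda>t. \<nu> \<bullet> g (l t)) has_derivative (\<lambda>t. \<nu> \<bullet> g' (t *\<^sub>R y))) (at 0)"
      using has_derivative_compose[OF l, of "\<lambda>z. \<nu> \<bullet> g z" "\<lambda>y. \<nu> \<bullet> g' y"] g(1)
      by (simp add: l0 has_derivative_inner_right)
    then show ?thesis
      by (simp add: has_field_derivative_def mult_commute_abs linear_cmul[OF has_derivative_linear[OF g(1)]])
  qed
  moreover have "\<nu> \<bullet> f'' y (X u) = (\<Sum>i\<in>UNIV. X u $ i * (\<nu> \<bullet> f'' y (axis i 1)))"
    by (subst expand[of "X u"], simp only: linear_sum[OF lin2] linear_cmul[OF lin2] inner_sum_right inner_scaleR_right)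
  ultimately show ?thesis using DERIV_unique by metis
qed


section \<open>The pointwise curvature bound\<close>

text \<open>
  The Gauss formula for the field \<open>p f\<close> gives \<open>h(y, \<xi>\<^sub>p) = \<surd>c \<langle>\<nu>, p y\<rangle>\<close> for each imaginary \<open>p\<close>.
  Two orthogonal imaginary units then provide an orthonormal family as in
  \<open>trace_sq_le_of_null_family\<close>, with images of length \<open>\<surd>c\<close>.
\<close>

theorem curvature_bound_if_hopf_fibres_tangent:
  fixes f :: "real^'m \<Rightarrow> quat^'k"
  assumes S: "open S" "u \<in> S" and sm: "smooth_on S f"
    and c: "c > 0" and sph: "\<And>z. z \<in> S \<Longrightarrow> f z \<in> sphere_of_curvature c"
    and dim: "CARD('m) + 2 = DIM(quat^'k)"
    and inj: "inj (frechet_derivative f (at u))"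
    and tang: "\<And>z p. z \<in> S \<Longrightarrow> p $ 1 = 0 \<Longrightarrow> qscale p (f z) \<in> range (frechet_derivative f (at z))"
  shows "(norm (mean_curvature f u))\<^sup>2 \<le> (norm_A_sq f u - 4 * c) * (real CARD('m) - 2)"
proof -
  define f' where "f' = (\<lambda>z. frechet_derivative f (at z))"
  define f'' where "f'' = (\<lambda>y v. frechet_derivative (\<lambda>z. f' z v) (at u) y)"
  define z where "z = f u"
  have ck: "Ck_on (Suc (Suc 0)) S f" using sm unfolding smooth_on_def by blast
  have der: "(f has_derivative f' w) (at w)" if "w \<in> S" for w
    using ck that frechet_derivative_works by (auto simp: f'_def)
  have der2: "((\<lambda>w. f' w v) has_derivative (\<lambda>y. f'' y v)) (at u)" for v
  proof -
    have "(\<lambda>w. f' w v) differentiable at u" using ck S(2) by (simp add: f'_def)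
    then show ?thesis by (simp add: frechet_derivative_works f''_def)
  qed
  have lin: "linear (f' w)" if "w \<in> S" for w using der[OF that] by (rule has_derivative_linear)
  have evS: "\<forall>\<^sub>F w in nhds u. w \<in> S" using S by (rule eventually_nhds_in_open)
  have symm: "f'' x y = f'' y x" for x y
    by (rule second_derivative_symmetric[OF S der der2])
  have lin1: "linear (\<lambda>y. f'' y v)" for v using der2 by (rule has_derivative_linear)
  have lin2: "linear (f'' y)" for y using lin1[of y] unfolding symm[of _ y] .
  have lD: "linear (f' u)" and iD: "inj (f' u)" using lin S(2) inj by (auto simp: f'_def)
  have fz: "f w \<bullet> f w = 1 / c" if "w \<in> S" for w
    using sph[OF that] c by (simp add: sphere_of_curvature_def dist_norm dot_square_norm power_divide)
  then have zz: "z \<bullet> z = 1 / c" using S by (simp add: z_def)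
  then have z0: "z \<noteq> 0" using c by auto
  \<comment> \<open>The position vector is orthogonal to the tangent space because \<open>|f|\<close> is constant.\<close>
  have zD: "z \<bullet> f' u v = 0" for v
  proof -
    have "((\<lambda>w. f w \<bullet> f w) has_derivative (\<lambda>v. f u \<bullet> f' u v + f' u v \<bullet> f u)) (at u)"
      by (intro has_derivative_inner der S)
    moreover have "((\<lambda>w. f w \<bullet> f w) has_derivative (\<lambda>v. 0)) (at u)"
      by (rule has_derivative_transform_within_open[OF has_derivative_const[of "1 / c"] S]) (simp add: fz)
    ultimately have "(\<lambda>v. f u \<bullet> f' u v + f' u v \<bullet> f u) = (\<lambda>v. 0)" by (rule has_derivative_unique)
    then show ?thesis by (metis z_def inner_commute mult_2 mult_eq_0_iff zero_neq_numeral)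
  qed
  obtain \<nu> where \<nu>: "norm \<nu> = 1" "{w. w \<bullet> z = 0 \<and> (\<forall>i. w \<bullet> f' u (axis i 1) = 0)} = span {\<nu>}"
      "range (f' u) = {w. w \<bullet> z = 0 \<and> w \<bullet> \<nu> = 0}"
    by (rule unit_normal_in_codimension_two[OF lD iD z0 zD dim])
  have \<nu>D: "\<nu> \<bullet> f' u v = 0" for v using \<nu>(3) by (metis (mono_tags, lifting) inner_commute mem_Collect_eq rangeI)
  have N: "normal_space f u = span {\<nu>}"
    using \<nu>(2) by (simp add: normal_space_def pd_def f'_def z_def)
  \<comment> \<open>The real part of \<open>r\<close> yields a multiple of the position vector, the imaginary part a tangent
    vector; both are orthogonal to the normal.\<close>
  have \<nu>z: "\<nu> \<bullet> qscale r z = 0" for r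
  proof -
    define r' where "r' = r - r $ 1 *\<^sub>R axis 1 1"
    have "r' $ 1 = 0" by (simp add: r'_def axis_def)
    then have "\<nu> \<bullet> qscale r' z = 0" using tang[OF S(2), of r'] \<nu>D by (auto simp: z_def f'_def)
    moreover have "\<nu> \<in> span {\<nu>}" by (simp add: span_base)
    then have "\<nu> \<bullet> z = 0" using \<nu>(2) by blast
    moreover have "qscale r z = qscale r' z + r $ 1 *\<^sub>R z"
      unfolding r'_def by (simp add: linear_diff[OF linear_qscale_left] linear_cmul[OF linear_qscale_left] qscale_one)
    ultimately show ?thesis by (simp add: inner_add_right)
  qed
  obtain J and E :: "real^'m^'m" where J: "linear J" "range J = range (f' u)" "\<And>x y. J x \<bullet> J y = x \<bullet> y"
      "\<And>x. f' u (E *v x) = J x"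
      "matrix_inv (\<chi> i j. f' u (axis i 1) \<bullet> f' u (axis j 1)) = E ** transpose E"
    using orthonormal_frame_of_injective[OF lD iD] by blast
  define b where "b = (\<lambda>y x. \<nu> \<bullet> f'' y x)"
  define B where "B = transpose E ** (\<chi> i j. b (axis i 1) (axis j 1)) ** E"
  have B: "y \<bullet> (B *v x) = b (E *v y) (E *v x)" for x y
  proof -
    have "linear (\<lambda>y. b y x)" "linear (b y)" for x y
      unfolding b_def using linear_compose[OF lin1, of "inner \<nu>"] linear_compose[OF lin2, of "inner \<nu>"]
      by (simp_all add: o_def bounded_linear.linear bounded_linear_inner_right)
    then show ?thesis
      unfolding B_def inner_matrix_congruence by (rule inner_bilinear_form_matrix)
  qed
  have "x \<bullet> (transpose B *v y) = x \<bullet> (B *v y)" for x y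
    by (metis B b_def symm dot_lmul_matrix inner_commute vector_transpose_matrix transpose_transpose)
  then have symB: "transpose B = B" unfolding matrix_eq using vector_eq_ldot by blast
  have curv: "norm_A_sq f u = B \<bullet> B" "(norm (mean_curvature f u))\<^sup>2 = (trace B)\<^sup>2"
    by (rule curvature_in_orthonormal_frame[OF N \<nu>(1)];
      use J(5) in \<open>simp add: metric_def pd_def[abs_def] f'_def B_def b_def f''_def\<close>)+

  \<comment> \<open>The coordinates, in the orthonormal frame, of the unit tangent vector along the orbit.\<close>
  define \<xi> where "\<xi> = (\<lambda>p. SOME x. J x = sqrt c *\<^sub>R qscale p z)"
  have \<xi>: "J (\<xi> p) = sqrt c *\<^sub>R qscale p z" if "p $ 1 = 0" for p
  proof -
    have "qscale p z \<in> range J" using tang[OF S(2) that] J(2) by (simp add: z_def f'_def)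
    then obtain x where "J x = qscale p z" by auto
    then have "J (sqrt c *\<^sub>R x) = sqrt c *\<^sub>R qscale p z" by (simp add: linear_cmul[OF J(1)])
    then show ?thesis unfolding \<xi>_def by (rule someI)
  qed
  have B\<xi>: "y \<bullet> (B *v \<xi> p) = sqrt c * (\<nu> \<bullet> qscale p (J y))" if p: "p $ 1 = 0" for y p
  proof -
    define X where "X = (\<lambda>w. SOME x. f' w x = qscale p (f w))"
    have X: "f' w (X w) = qscale p (f w)" if "w \<in> S" for w
      using tang[OF that p] unfolding X_def f'_def by (metis (mono_tags, lifting) imageE someI)
    have d: "((\<lambda>w. qscale p (f w)) has_derivative (\<lambda>y. qscale p (f' u y))) (at u)"
      by (rule bounded_linear.has_derivative[OF linear_qscale[unfolded linear_conv_bounded_linear] der[OF S(2)]])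
    have key: "\<nu> \<bullet> f'' y (X u) = \<nu> \<bullet> qscale p (f' u y)" for y
      by (rule normal_derivative_of_tangent_field[OF eventually_mono[OF evS lin] der2 lin2 iD \<nu>D d
            eventually_mono[OF evS X]])
    have "f' u (E *v \<xi> p) = f' u (sqrt c *\<^sub>R X u)"
      using X[OF S(2)] by (simp add: J(4) \<xi>[OF p] linear_cmul[OF lD] z_def)
    then have "E *v \<xi> p = sqrt c *\<^sub>R X u" using iD by (simp add: inj_eq)
    then show ?thesis by (simp add: B b_def linear_cmul[OF lin2] key J(4))
  qed
  \<comment> \<open>By skew-symmetry \<open>\<langle>\<nu>, p y\<rangle> = - \<langle>p \<nu>, y\<rangle>\<close>, and \<open>p \<nu>\<close> is itself tangent.\<close>
  have nB\<xi>: "(norm (B *v \<xi> p))\<^sup>2 = c * (p \<bullet> p)" if p: "p $ 1 = 0" for p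
  proof -
    have "qscale p \<nu> \<bullet> z = 0" using inner_qscale_skew[OF p, of \<nu> z] \<nu>z by simp
    moreover have "qscale p \<nu> \<bullet> \<nu> = 0" using inner_qscale_skew[OF p, of \<nu> \<nu>] by (simp add: inner_commute)
    ultimately have "qscale p \<nu> \<in> range J" using J(2) \<nu>(3) by simp
    then obtain w where w: "J w = qscale p \<nu>" by (metis imageE)
    have "y \<bullet> (B *v \<xi> p) = y \<bullet> (- sqrt c *\<^sub>R w)" for y
    proof -
      have "y \<bullet> (B *v \<xi> p) = - sqrt c * (J w \<bullet> J y)"
        by (simp add: B\<xi>[OF p] inner_qscale_skew[OF p] w)
      also have "\<dots> = y \<bullet> (- sqrt c *\<^sub>R w)" unfolding J(3) by (simp add: inner_commute)
      finally show ?thesis .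
    qed
    then have "B *v \<xi> p = - sqrt c *\<^sub>R w" using vector_eq_ldot by blast
    then have "(norm (B *v \<xi> p))\<^sup>2 = c * (w \<bullet> w)"
      using c by (simp add: power_mult_distrib power2_norm_eq_inner)
    also have "w \<bullet> w = p \<bullet> p"
      using J(3)[of w w] \<nu>(1) by (simp add: w inner_qscale_qscale norm_eq_1)
    finally show ?thesis .
  qed
  define x where "x = (\<lambda>a::4. \<xi> (axis a 1))"
  \<comment> \<open>Indices of the imaginary units \<open>i\<close> and \<open>j\<close>; index 1 is the real part.\<close>
  define I where "I = {2, 3 :: 4}"
  have im: "(axis a 1 :: quat) $ 1 = 0" if "a \<in> I" for a using that by (auto simp: I_def axis_def)
  have "(trace B)\<^sup>2 \<le> (B \<bullet> B - 2 * (\<Sum>a\<in>I. (norm (B *v x a))\<^sup>2)) * (real CARD('m) - real (card I))"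
  proof (rule trace_sq_le_of_null_family[OF symB])
    show "finite I" by (simp add: I_def)
    show "x a \<bullet> x a' = (if a = a' then 1 else 0)" if "a \<in> I" "a' \<in> I" for a a'
    proof -
      have "x a \<bullet> x a' = J (x a) \<bullet> J (x a')" by (simp add: J(3))
      also have "\<dots> = (sqrt c * sqrt c) * ((axis a 1 \<bullet> (axis a' 1 :: quat)) * (1 / c))"
        unfolding x_def \<xi>[OF im[OF that(1)]] \<xi>[OF im[OF that(2)]] by (simp add: inner_qscale_qscale zz)
      finally show ?thesis using c by (simp add: inner_axis_axis)
    qed
    show "x a \<bullet> (B *v x a') = 0" if "a \<in> I" "a' \<in> I" for a a'
      by (simp add: x_def B\<xi> \<xi> im that linear_cmul[OF linear_qscale] qscale_qscale \<nu>z)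
  qed
  moreover have "(\<Sum>a\<in>I. (norm (B *v x a))\<^sup>2) = (\<Sum>a\<in>I. c)"
    by (rule sum.cong) (auto simp: x_def nB\<xi> im inner_axis_axis)
  moreover have "card I = 2" by (simp add: I_def)
  ultimately show ?thesis by (simp add: curv)
qed


section \<open>Invariance of the image and tangency of the orbits\<close>

text \<open>
  For a unit imaginary \<open>q\<close> the curve \<open>t \<mapsto> (cos t + q sin t) f(w)\<close> stays in \<open>X\<close> by invariance and,
  for small \<open>t\<close>, in the open set \<open>W\<close>, so it runs on the embedded piece \<open>f ` K\<close>; its velocity at
  \<open>t = 0\<close> is \<open>q f(w)\<close>.
\<close>

lemma hopf_fibre_tangent_if_image_locally_invariant:
  fixes f :: "real^'m \<Rightarrow> quat^'k"
  assumes f: "smooth_on K f" "compact K" "inj_on f K"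
    and X: "S3_invariant X" "f w \<in> X" and W: "open W" "X \<inter> W \<subseteq> f ` K"
    and w: "w \<in> K" "f w \<in> W" "inj (frechet_derivative f (at w))"
    and p: "p $ 1 = 0"
  shows "qscale p (f w) \<in> range (frechet_derivative f (at w))"
proof -
  have lin: "linear (frechet_derivative f (at w))"
    using smooth_on_imp_has_derivative[OF f(1) w(1)] by (rule has_derivative_linear)
  have unit: "qscale q (f w) \<in> range (frechet_derivative f (at w))" if q: "q $ 1 = 0" "norm q = 1" for q
  proof -
    define e where "e = (axis 1 1 :: quat)"
    define \<gamma> where "\<gamma> = (\<lambda>t. qscale (cos t *\<^sub>R e + sin t *\<^sub>R q) (f w))"
    have "((\<lambda>t. cos t *\<^sub>R e + sin t *\<^sub>R q) has_vector_derivative q) (at 0)"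
      by (auto intro!: derivative_eq_intros simp: has_vector_derivative_def)
    then have \<gamma>': "(\<gamma> has_vector_derivative qscale q (f w)) (at 0)"
      unfolding \<gamma>_def
      by (rule bounded_linear.has_vector_derivative[OF linear_qscale_left[unfolded linear_conv_bounded_linear]])
    have \<gamma>0: "\<gamma> 0 = f w" by (simp add: \<gamma>_def e_def qscale_one)
    have "\<gamma> t \<in> X" for t
    proof -
      have "e \<bullet> q = 0" using q(1) by (simp add: e_def inner_axis')
      then have "(norm (cos t *\<^sub>R e + sin t *\<^sub>R q))\<^sup>2 = (cos t)\<^sup>2 + (sin t)\<^sup>2"
        using q(2) unfolding power2_norm_eq_inner
        by (simp add: inner_add_left inner_add_right norm_eq_1 e_def inner_commute inner_axis_axis power2_eq_square)
      then have "norm (cos t *\<^sub>R e + sin t *\<^sub>R q) = 1"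
        by (metis norm_ge_zero power2_eq_iff_nonneg power_one sin_cos_squared_add2 zero_le_one)
      then show ?thesis using X unfolding S3_invariant_def \<gamma>_def by blast
    qed
    moreover have "isCont \<gamma> 0"
      using \<gamma>' has_derivative_continuous unfolding has_vector_derivative_def by blast
    then have "\<forall>\<^sub>F t in nhds 0. \<gamma> t \<in> W"
      using topological_tendstoD[OF isCont_tendsto_nhds W(1)] w(2) \<gamma>0 by metis
    then have "\<forall>\<^sub>F t in nhds 0. \<gamma> t \<in> f ` K"
      by eventually_elim (use \<open>\<And>t. \<gamma> t \<in> X\<close> W(2) in blast)
    moreover have "continuous_on K f" using f(1) by (rule smooth_on_imp_continuous_on)
    ultimately show ?thesis
      using vector_in_range_of_curve_in_image[OF smooth_on_imp_has_derivative[OF f(1) w(1)] w(3) f(2) _ f(3) w(1) \<gamma>' \<gamma>0]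
      by blast
  qed
  show ?thesis
  proof (cases "p = 0")
    case True
    then show ?thesis using linear_0[OF linear_qscale_left] linear_0[OF lin] by (metis rangeI)
  next
    case False
    then obtain v where "qscale (p /\<^sub>R norm p) (f w) = frechet_derivative f (at w) v"
      using unit[of "p /\<^sub>R norm p"] p by auto
    then have "frechet_derivative f (at w) (norm p *\<^sub>R v) = norm p *\<^sub>R qscale (p /\<^sub>R norm p) (f w)"
      by (simp add: linear_cmul[OF lin])
    also have "\<dots> = qscale p (f w)"
      using False by (simp add: linear_cmul[OF linear_qscale_left])
    finally have "qscale p (f w) = frechet_derivative f (at w) (norm p *\<^sub>R v)" by simp
    then show ?thesis by blast
  qed
qed

text \<open>
  If the first set does not cover \<open>X\<close>, the part of \<open>X\<close> outside it is nonempty, relatively open, and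
  covered by the other sets.
\<close>

lemma finite_closed_cover_relative_interior:
  fixes X :: "'a::topological_space set"
  assumes "finite I" "X \<noteq> {}" "X \<subseteq> (\<Union>i\<in>I. K i)" "\<And>i. i \<in> I \<Longrightarrow> closed (K i)"
  shows "\<exists>i\<in>I. \<exists>W. open W \<and> X \<inter> W \<noteq> {} \<and> X \<inter> W \<subseteq> K i"
  using assms
proof (induction I arbitrary: X rule: finite_induct)
  case empty
  then show ?case by simp
next
  case (insert i I)
  show ?case
  proof (cases "X \<subseteq> K i")
    case True
    then show ?thesis using insert.prems(1) by (intro bexI[of _ i] exI[of _ UNIV]) auto
  next
    case False
    then have "\<exists>j\<in>I. \<exists>W. open W \<and> (X - K i) \<inter> W \<noteq> {} \<and> (X - K i) \<inter> W \<subseteq> K j"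
      by (intro insert.IH) (use insert.prems in auto)
    then obtain j W where W: "j \<in> I" "open W" "(X - K i) \<inter> W \<noteq> {}" "(X - K i) \<inter> W \<subseteq> K j"
      by blast
    have "open (W - K i)" using W(2) insert.prems(3) by (simp add: open_Diff)
    moreover have "X \<inter> (W - K i) = (X - K i) \<inter> W" by blast
    ultimately show ?thesis using W by (metis insertI2)
  qed
qed

text \<open>
  Cover \<open>M\<close> by finitely many coordinate balls on whose doubles \<open>F\<close> is injective.  The images of the
  closed balls are compact and cover the image of \<open>F\<close>, so one of them contains a nonempty relatively
  open part of it.  The double \<open>K\<close> of that ball, rather than the ball itself, is used for the open set
  \<open>S\<close>: the points of the ball with values in \<open>W\<close> may all lie on its boundary sphere.
\<close>

lemma exists_chart_with_relatively_open_image: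
  fixes F :: "'p \<Rightarrow> 'e::euclidean_space" and \<A> :: "('p, 'm::finite) atlas"
  assumes H: "closed_hypersurface M \<A> F c"
  obtains U \<phi> K S W where "(U, \<phi>) \<in> \<A>" "compact K" "K \<subseteq> \<phi> ` U" "inj_on (F \<circ> parametrization U \<phi>) K"
    "open S" "S \<noteq> {}" "S \<subseteq> K" "open W" "(F \<circ> parametrization U \<phi>) ` S \<subseteq> W"
    "F ` topspace M \<inter> W \<subseteq> (F \<circ> parametrization U \<phi>) ` K"
proof -
  have M: "topspace M \<noteq> {}" "compact_space M" "smooth_atlas M \<A>"
    using H by (auto simp: closed_hypersurface_def closed_manifold_def)
  have chart: "openin M U" "open (\<phi> ` U)" "homeomorphic_map (subtopology M U) (top_of_set (\<phi> ` U)) \<phi>"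
    if "(U, \<phi>) \<in> \<A>" for U \<phi>
    using M(3) that unfolding smooth_atlas_def by blast+
  have imm: "smooth_on (\<phi> ` U) (F \<circ> parametrization U \<phi>)"
      "\<And>u. u \<in> \<phi> ` U \<Longrightarrow> inj (frechet_derivative (F \<circ> parametrization U \<phi>) (at u))"
    if "(U, \<phi>) \<in> \<A>" for U \<phi>
    using H that unfolding closed_hypersurface_def by blast+
  have sub: "U \<subseteq> topspace M" if "(U, \<phi>) \<in> \<A>" for U \<phi>
    using chart(1)[OF that] by (rule openin_subset)
  have inj: "inj_on \<phi> U" if "(U, \<phi>) \<in> \<A>" for U \<phi>
    using homeomorphic_imp_injective_map[OF chart(3)[OF that]] sub[OF that] by (simp add: Int_absorb1)
  define R where "R = {(U, \<phi>, u, r). (U, \<phi>) \<in> \<A> \<and> 0 < r \<and> cball u (2 * r) \<subseteq> \<phi> ` U \<and>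
    inj_on (F \<circ> parametrization U \<phi>) (cball u (2 * r))}"
  define V where "V = (\<lambda>(U, \<phi>, u, r :: real). {q \<in> U. \<phi> q \<in> ball (u :: real^'m) r} :: 'p set)"
  define K where "K = (\<lambda>(U, \<phi>, u :: real^'m, r :: real). (F \<circ> parametrization U \<phi>) ` cball u r)"
  have "openin M (V x)" if xR: "x \<in> R" for x
  proof -
    obtain U \<phi> u r where x: "x = (U, \<phi>, u, r)" "(U, \<phi>) \<in> \<A>" "cball u (2 * r) \<subseteq> \<phi> ` U" "0 < r"
      using xR by (auto simp: R_def)
    have "continuous_map (subtopology M U) (top_of_set (\<phi> ` U)) \<phi>"
      using chart(3)[OF x(2)] by (rule homeomorphic_imp_continuous_map)
    then have "continuous_map (subtopology M U) euclidean \<phi>"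
      by (simp add: continuous_map_in_subtopology)
    then have "openin (subtopology M U) {q \<in> topspace (subtopology M U). \<phi> q \<in> ball u r}"
      by (rule openin_continuous_map_preimage) simp
    then have "openin (subtopology M U) (V x)"
      using sub[OF x(2)] by (simp add: x V_def Int_absorb1)
    then show ?thesis using chart(1)[OF x(2)] openin_trans_full by blast
  qed
  moreover have "topspace M \<subseteq> \<Union> (V ` R)"
  proof
    fix q assume "q \<in> topspace M"
    then obtain U \<phi> where U: "(U, \<phi>) \<in> \<A>" "q \<in> U"
      using M(3) unfolding smooth_atlas_def by blast
    obtain r where r: "r > 0" "cball (\<phi> q) r \<subseteq> \<phi> ` U" "inj_on (F \<circ> parametrization U \<phi>) (cball (\<phi> q) r)"
      using immersion_locally_injective[OF chart(2)[OF U(1)] _ imm(1)[OF U(1)] imm(2)[OF U(1)]] U(2) by blast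
    have "(U, \<phi>, \<phi> q, r / 2) \<in> R" using r U by (simp add: R_def)
    moreover have "q \<in> V (U, \<phi>, \<phi> q, r / 2)" using r U by (simp add: V_def)
    ultimately show "q \<in> \<Union> (V ` R)" by blast
  qed
  ultimately obtain \<F> where "finite \<F>" "\<F> \<subseteq> V ` R" "topspace M \<subseteq> \<Union>\<F>"
    using M(2)[unfolded compact_space_alt, rule_format, of "V ` R"] by blast
  then obtain R' where R': "finite R'" "R' \<subseteq> R" "topspace M \<subseteq> \<Union> (V ` R')"
    by (metis finite_subset_image)
  have "F ` topspace M \<subseteq> (\<Union>x\<in>R'. K x)"
  proof
    fix y assume "y \<in> F ` topspace M"
    then obtain q x where q: "y = F q" "x \<in> R'" "q \<in> V x" using R'(3) by blast
    obtain U \<phi> u r where x: "x = (U, \<phi>, u, r)" "(U, \<phi>) \<in> \<A>"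
      using q(2) R'(2) by (auto simp: R_def)
    have "y = (F \<circ> parametrization U \<phi>) (\<phi> q)" "\<phi> q \<in> cball u r"
      using q x inj[OF x(2)] by (auto simp: V_def)
    then have "y \<in> K x" unfolding K_def x by blast
    then show "y \<in> (\<Union>x\<in>R'. K x)" using q(2) by blast
  qed
  moreover have cont: "continuous_on (\<phi> ` U) (F \<circ> parametrization U \<phi>)" if "(U, \<phi>) \<in> \<A>" for U \<phi>
    using imm(1)[OF that] by (rule smooth_on_imp_continuous_on)
  have "closed (K x)" if xR: "x \<in> R'" for x
  proof -
    obtain U \<phi> u r where x: "x = (U, \<phi>, u, r)" "(U, \<phi>) \<in> \<A>" "cball u (2 * r) \<subseteq> \<phi> ` U" "0 < r"
      using xR R'(2) by (auto simp: R_def)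
    have "cball u r \<subseteq> cball u (2 * r)" using x(4) by (intro subset_cball) simp
    then have "continuous_on (cball u r) (F \<circ> parametrization U \<phi>)"
      using cont[OF x(2)] x(3) by (meson continuous_on_subset order_trans)
    then show ?thesis
      unfolding K_def x by (simp add: compact_continuous_image compact_imp_closed del: image_comp)
  qed
  ultimately obtain x W where W: "x \<in> R'" "open W" "F ` topspace M \<inter> W \<noteq> {}" "F ` topspace M \<inter> W \<subseteq> K x"
    using finite_closed_cover_relative_interior[OF R'(1)] M(1) by (metis image_is_empty)
  obtain U \<phi> u r where x: "x = (U, \<phi>, u, r)" "(U, \<phi>) \<in> \<A>" "cball u (2 * r) \<subseteq> \<phi> ` U" "0 < r"
      "inj_on (F \<circ> parametrization U \<phi>) (cball u (2 * r))"
    using W(1) R'(2) by (auto simp: R_def)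
  define f where "f = F \<circ> parametrization U \<phi>"
  define S where "S = ball u (2 * r) \<inter> f -` W"
  have W': "F ` topspace M \<inter> W \<subseteq> f ` cball u r" using W(4) by (simp add: K_def x f_def)
  have "continuous_on (ball u (2 * r)) f"
    using cont[OF x(2)] x(3) ball_subset_cball unfolding f_def by (meson continuous_on_subset order_trans)
  then have "open S" unfolding S_def using W(2) by (intro continuous_open_preimage) auto
  moreover have "S \<noteq> {}"
  proof -
    obtain y where "y \<in> W" "y \<in> f ` cball u r" using W' W(3) by blast
    then obtain v where "v \<in> cball u r" "f v \<in> W" by blast
    then have "v \<in> S" using x(4) by (simp add: S_def)
    then show ?thesis by blast
  qed
  moreover have "f ` cball u r \<subseteq> f ` cball u (2 * r)"
    using x(4) by (intro image_mono subset_cball) simp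
  then have "F ` topspace M \<inter> W \<subseteq> f ` cball u (2 * r)" using W' by blast
  moreover have "S \<subseteq> cball u (2 * r)" "f ` S \<subseteq> W" by (auto simp: S_def)
  ultimately show thesis
    using that[OF x(2) compact_cball x(3) x(5)] W(2) unfolding f_def by metis
qed


section \<open>Nonexistence of pinched invariant hypersurfaces\<close>

theorem corollary1p4:
  fixes n :: nat and c :: real
  assumes "n \<ge> 1" and "c > 0" and "CARD('k::finite) = n + 1"
  shows "\<nexists>(M :: 'p topology) (\<A> :: ('p, 'm::finite) atlas) (F :: 'p \<Rightarrow> quat^'k).
    closed_hypersurface M \<A> F c \<and>
    S3_invariant (F ` topspace M) \<and>
    (\<forall>(U, \<phi>)\<in>\<A>. \<forall>u\<in>\<phi> ` U.
       norm_A_sq (F \<circ> parametrization U \<phi>) u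
         < 1 / (4 * real n) * (norm (mean_curvature (F \<circ> parametrization U \<phi>) u))\<^sup>2 + 4 * c)"
proof clarify
  fix M :: "'p topology" and \<A> :: "('p, 'm) atlas" and F :: "'p \<Rightarrow> quat^'k"
  assume H: "closed_hypersurface M \<A> F c" and inv: "S3_invariant (F ` topspace M)"
    and pinched: "\<forall>(U, \<phi>)\<in>\<A>. \<forall>u\<in>\<phi> ` U. norm_A_sq (F \<circ> parametrization U \<phi>) u
      < 1 / (4 * real n) * (norm (mean_curvature (F \<circ> parametrization U \<phi>) u))\<^sup>2 + 4 * c"
  obtain U \<phi> K S W where U: "(U, \<phi>) \<in> \<A>" and K: "compact K" "K \<subseteq> \<phi> ` U"
      "inj_on (F \<circ> parametrization U \<phi>) K"
    and S: "open S" "S \<noteq> {}" "S \<subseteq> K" and W: "open W" "(F \<circ> parametrization U \<phi>) ` S \<subseteq> W"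
      "F ` topspace M \<inter> W \<subseteq> (F \<circ> parametrization U \<phi>) ` K"
    using exists_chart_with_relatively_open_image[OF H] by metis
  define f where "f = F \<circ> parametrization U \<phi>"
  have dim: "CARD('m) + 2 = DIM(quat^'k)"
    using H by (simp add: closed_hypersurface_def)
  have smooth: "smooth_on (\<phi> ` U) f"
    and imm: "inj (frechet_derivative f (at w))" if "w \<in> \<phi> ` U" for w
    using H U that unfolding closed_hypersurface_def f_def by blast+
  have "U \<subseteq> topspace M"
    using H U openin_subset
    unfolding closed_hypersurface_def closed_manifold_def smooth_atlas_def by blast
  then have image: "f w \<in> F ` topspace M" if "w \<in> \<phi> ` U" for w
    using inv_into_into[OF that] by (auto simp: f_def)
  then have sphere: "f w \<in> sphere_of_curvature c" if "w \<in> \<phi> ` U" for w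
    using that H unfolding closed_hypersurface_def by blast
  obtain u where u: "u \<in> S" using S(2) by blast
  have chart: "w \<in> \<phi> ` U" if "w \<in> S" for w using that S(3) K(2) by blast
  have smK: "smooth_on K f" using smooth[OF chart[OF u]] K(2) by (rule smooth_on_subset)
  have "(norm (mean_curvature f u))\<^sup>2 \<le> (norm_A_sq f u - 4 * c) * (real CARD('m) - 2)"
  proof (rule curvature_bound_if_hopf_fibres_tangent[OF S(1) u _ \<open>c > 0\<close> _ dim imm[OF chart[OF u]]])
    show "smooth_on S f" using smK S(3) by (rule smooth_on_subset)
    show "f w \<in> sphere_of_curvature c" if "w \<in> S" for w using sphere[OF chart[OF that]] .
    show "qscale p (f w) \<in> range (frechet_derivative f (at w))" if w: "w \<in> S" and p: "p $ 1 = 0" for w p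
    proof (rule hopf_fibre_tangent_if_image_locally_invariant
        [OF smK K(1) K(3)[folded f_def] inv image[OF chart[OF w]] W(1) W(3)[folded f_def]])
      show "w \<in> K" using w S(3) by blast
      show "f w \<in> W" using w W(2) by (auto simp: f_def)
    qed (use imm[OF chart[OF w]] p in auto)
  qed
  also have "real CARD('m) - 2 = 4 * real n"
    using dim assms(3) by simp
  finally have "(norm (mean_curvature f u))\<^sup>2 / (4 * real n) \<le> norm_A_sq f u - 4 * c"
    using \<open>n \<ge> 1\<close> by (simp add: divide_le_eq)
  moreover have "norm_A_sq f u < 1 / (4 * real n) * (norm (mean_curvature f u))\<^sup>2 + 4 * c"
    using pinched U chart[OF u] unfolding f_def by blast
  ultimately show False by simp
qed


end
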